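(* Let $p$ be a prime, $\mathcal{K}$ a complete non-Archimedean field of characteristic $p$, $\lambda\in\mathcal{K}$ not a root of unity with $|1-\lambda|<1$, and let $f(z)=z\left(\lambda+\sum_{n\ge 1}a_nz^n\right)\in\mathcal{K}[[z]]$ be locally analytic at $z=0$, with $a_n\neq 0$ for at least one $n\ge 1$. If $f$ is $k$-dominant for some integer $k\ge 1$, then $f$ is non-linearizable.
   Context: Locally analytic at $z=0$ means having positive radius of convergence. $f$ is (locally) linearizable at $z=0$ if there is a power series $h(z)=z\sum_{n\ge 0}b_nz^n\in\mathcal{K}[[z]]$, locally analytic at $z=0$ and with $b_0\ne0$, such that $h\circ f\circ h^{-1}(z)=\lambda z$; otherwise $f$ is non-linearizable. Notation. $\mathbb{N}=\{0,1,\dots\}$. Put $\mu:=\lambda-1$ and $\mathrm{val}_\mu(x):=\ln|x|/\ln|\mu|$ for $x\in\mathcal{K}$ (with $\mathrm{val}_\mu(0)=+\infty$). $\mathrm{val}_p$ is the $p$-adic valuation on $\mathbb{Z}$ (with $\mathrm{val}_p(0)=+\infty$). Put $a_0:=\lambda$, $u:=\gcd(i\ge1 : a_i\neq 0)$, $\tau:=\mathrm{val}_p(u)$. For integers $0\le r<s$ let $I(r,s)$ be the set of $\underline{\alpha}=(\alpha_0,\dots,\alpha_{s-r})\in\mathbb{N}^{s-r+1}$ with $\alpha_i=0$ whenever $u\nmid i$, $|\underline\alpha|:=\sum_{i=0}^{s-r}\alpha_i=r+1$ and $\|\underline\alpha\|:=\sum_{i=1}^{s-r}i\alpha_i=s-r$.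 Put $\underline a^{\underline\alpha}:=\prod_{i}a_i^{\alpha_i}$ (with $0^0=1$), let $\binom{r+1}{\underline\alpha}_p$ be the image in $\mathcal{K}$ of the multinomial coefficient $\binom{r+1}{\alpha_0,\dots,\alpha_{s-r}}$, and $$\Phi(r,s):=\frac{1}{\lambda(1-\lambda^s)}\sum_{\underline\alpha\in I(r,s)}\binom{r+1}{\underline\alpha}_p\underline a^{\underline\alpha}.$$ For integers $0\le r<s$ and $k\in\mathbb{N}$, let $S_k(r,s)$ be the set of all strictly increasing integer sequences $\underline\beta=(\beta_0,\dots,\beta_{m(\underline\beta)+1})$ with $m(\underline\beta)\ge 0$, $\beta_0=r$, $\beta_{m(\underline\beta)+1}=s$ and $p^k\nmid\beta_j$ for all $1\le j\le m(\underline\beta)$. Put $\Phi(\underline\beta):=\prod_{j=0}^{m(\underline\beta)}\Phi(u\beta_j,u\beta_{j+1})$ and $\phi_k(r,s):=\sum_{\underline\beta\in S_k(r,s)}\Phi(\underline\beta)$. Put $$\psi_k(r,s):=\phi_k(r,s)\,\frac{1-\lambda^{us}}{(1-\lambda^{p^{k+\tau}})\lambda^{us-1}}.$$ For $r,s$ both divisible by $p^k$ put $M_k(r,s):=\mathrm{val}_\mu(\psi_k(r,s))/(s-r)$, and let $M_k:=\inf\{M_k(r,s) : 0\le r<s,\ p^k\mid r,\ p^k\mid s\}$. For an integer $k\ge 1$, $f$ is $k$-dominant if $$\min_{d\in\{1,\dots,p-1\}}M_k(0,dp^k)\le\min_{\ell\in\{0,\dots,k-1\}}M_\ell-p^{\tau-1}.$$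 *)

theory Defs
  imports "HOL-Analysis.Analysis" "HOL-Computational_Algebra.Computational_Algebra"
begin

section \<open>Complete non-Archimedean fields\<close>

text \<open>
  The absolute value is an explicit function: the library class of real normed fields forces
  characteristic 0.
\<close>

locale nonarch_field =
  fixes absv :: "'a::field \<Rightarrow> real"
  assumes absv_nonneg: "0 \<le> absv x"
    and absv_eq_0_iff: "absv x = 0 \<longleftrightarrow> x = 0"
    and absv_mult: "absv (x * y) = absv x * absv y"
    and absv_add_le_max: "absv (x + y) \<le> max (absv x) (absv y)"
begin

lemma absv_1: "absv 1 = 1"
  using absv_mult[of 1 1] absv_eq_0_iff[of 1] by simp

lemma absv_minus: "absv (- x) = absv x"
proof -
  have "absv (- 1) * absv (- 1) = 1"
    using absv_mult[of "- 1" "- 1"] absv_1 by simp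
  then have "absv (- 1) = 1"
    using absv_nonneg[of "- 1"] by (auto simp: square_eq_1_iff)
  then show ?thesis
    using absv_mult[of "- 1" x] by simp
qed

sublocale Metric_space UNIV "\<lambda>x y. absv (x - y)"
proof
  show "absv (x - y) = absv (y - x)" for x y
    using absv_minus[of "x - y"] by simp
  show "absv (x - z) \<le> absv (x - y) + absv (y - z)" for x y z
    using absv_add_le_max[of "x - y" "y - z"] absv_nonneg[of "x - y"] absv_nonneg[of "y - z"]
    by simp
qed (use absv_nonneg absv_eq_0_iff in auto)

end

locale complete_nonarch_field = nonarch_field +
  assumes mcomplete: mcomplete


section \<open>Local analyticity and linearizability\<close>

text \<open>The Cauchy--Hadamard formula, as in the library's \<open>conv_radius\<close>.\<close>

definition nonarch_conv_radius :: "('a::field \<Rightarrow> real) \<Rightarrow> 'a fps \<Rightarrow> ereal" where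
  "nonarch_conv_radius absv f =
     inverse (limsup (\<lambda>n. ereal (root n (absv (fps_nth f n)))))"

definition locally_analytic :: "('a::field \<Rightarrow> real) \<Rightarrow> 'a fps \<Rightarrow> bool" where
  "locally_analytic absv f \<longleftrightarrow> nonarch_conv_radius absv f > 0"

text \<open>
  Here \<open>fps_inv h\<close> is the compositional inverse of \<open>h = fps_X * b\<close>, which has nonzero linear
  coefficient \<open>fps_nth b 0\<close>.
\<close>

definition linearizable :: "('a::field \<Rightarrow> real) \<Rightarrow> 'a \<Rightarrow> 'a fps \<Rightarrow> bool" where
  "linearizable absv lam f \<longleftrightarrow>
     (\<exists>b h. h = fps_X * b \<and> fps_nth b 0 \<noteq> 0 \<and> locally_analytic absv h \<and>
            h oo f oo fps_inv h = fps_const lam * fps_X)"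


section \<open>The functions \<open>\<Phi>\<close>, \<open>\<phi>\<^sub>k\<close> and \<open>\<psi>\<^sub>k\<close>\<close>

text \<open>
  Throughout, \<open>a\<close> is the sequence of coefficients of \<open>f(z)/z\<close>, so that \<open>\<lambda> = a 0\<close>.
\<close>

definition exp_gcd :: "(nat \<Rightarrow> 'a::field) \<Rightarrow> nat" where
  "exp_gcd a = Gcd {i. 1 \<le> i \<and> a i \<noteq> 0}"

definition exp_val :: "nat \<Rightarrow> (nat \<Rightarrow> 'a::field) \<Rightarrow> nat" where
  "exp_val p a = multiplicity p (exp_gcd a)"

text \<open>A multi-index of length \<open>s - r + 1\<close> is a function vanishing beyond \<open>s - r\<close>.\<close>

definition multi_indices :: "nat \<Rightarrow> nat \<Rightarrow> nat \<Rightarrow> (nat \<Rightarrow> nat) set" where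
  "multi_indices u r s =
     {\<alpha>. (\<forall>i>s - r. \<alpha> i = 0) \<and> (\<forall>i. \<not> u dvd i \<longrightarrow> \<alpha> i = 0) \<and>
         (\<Sum>i=0..s - r. \<alpha> i) = r + 1 \<and> (\<Sum>i=1..s - r. i * \<alpha> i) = s - r}"

definition multinom :: "nat \<Rightarrow> (nat \<Rightarrow> nat) \<Rightarrow> nat \<Rightarrow> nat" where
  "multinom n \<alpha> d = fact n div (\<Prod>i=0..d. fact (\<alpha> i))"

definition Phi :: "(nat \<Rightarrow> 'a::field) \<Rightarrow> nat \<Rightarrow> nat \<Rightarrow> 'a" where
  "Phi a r s =
     1 / (a 0 * (1 - a 0 ^ s)) *
     (\<Sum>\<alpha>\<in>multi_indices (exp_gcd a) r s.
        of_nat (multinom (r + 1) \<alpha> (s - r)) * (\<Prod>i=0..s - r. a i ^ \<alpha> i))"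

text \<open>A list \<open>\<beta>\<close> of length \<open>m + 2\<close> has interior indices \<open>1, ..., m\<close>.\<close>

definition step_seqs :: "nat \<Rightarrow> nat \<Rightarrow> nat \<Rightarrow> nat \<Rightarrow> nat list set" where
  "step_seqs p k r s =
     {\<beta>. 2 \<le> length \<beta> \<and> sorted_wrt (<) \<beta> \<and> hd \<beta> = r \<and> last \<beta> = s \<and>
         (\<forall>j. 1 \<le> j \<and> j \<le> length \<beta> - 2 \<longrightarrow> \<not> p ^ k dvd \<beta> ! j)}"

definition Phi_seq :: "(nat \<Rightarrow> 'a::field) \<Rightarrow> nat list \<Rightarrow> 'a" where
  "Phi_seq a \<beta> =
     (\<Prod>j=0..length \<beta> - 2. Phi a (exp_gcd a * \<beta> ! j) (exp_gcd a * \<beta> ! (j + 1)))"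

definition phi :: "nat \<Rightarrow> (nat \<Rightarrow> 'a::field) \<Rightarrow> nat \<Rightarrow> nat \<Rightarrow> nat \<Rightarrow> 'a" where
  "phi p a k r s = (\<Sum>\<beta>\<in>step_seqs p k r s. Phi_seq a \<beta>)"

definition psi :: "nat \<Rightarrow> (nat \<Rightarrow> 'a::field) \<Rightarrow> nat \<Rightarrow> nat \<Rightarrow> nat \<Rightarrow> 'a" where
  "psi p a k r s =
     phi p a k r s *
     ((1 - a 0 ^ (exp_gcd a * s)) /
      ((1 - a 0 ^ (p ^ (k + exp_val p a))) * a 0 ^ (exp_gcd a * s - 1)))"

text \<open>Both index sets are finite, so the sums above are genuine.\<close>

lemma finite_multi_indices: "finite (multi_indices u r s)"
proof (rule finite_subset)
  let ?F = "{\<alpha>. \<forall>i. (i \<in> {0..s - r} \<longrightarrow> \<alpha> i \<in> {0..r + 1}) \<and> (i \<notin> {0..s - r} \<longrightarrow> \<alpha> i = (0::nat))}"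
  show "finite ?F"
    by (rule finite_set_of_finite_funs) auto
  show "multi_indices u r s \<subseteq> ?F"
  proof
    fix \<alpha> assume \<alpha>: "\<alpha> \<in> multi_indices u r s"
    have "\<alpha> i \<le> r + 1" if "i \<le> s - r" for i
      using member_le_sum[of i "{0..s - r}" \<alpha>] that \<alpha> by (simp add: multi_indices_def)
    then show "\<alpha> \<in> ?F"
      using \<alpha> by (auto simp: multi_indices_def)
  qed
qed

lemma finite_step_seqs: "finite (step_seqs p k r s)"
proof -
  have "\<beta> = sorted_list_of_set (set \<beta>) \<and> set \<beta> \<subseteq> {..s}" if "\<beta> \<in> step_seqs p k r s" for \<beta>
  proof -
    have \<beta>: "sorted_wrt (<) \<beta>" "last \<beta> = s" "\<beta> \<noteq> []"
      using that by (auto simp: step_seqs_def)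
    have "x \<le> s" if "x \<in> set \<beta>" for x
    proof -
      have "\<beta> = butlast \<beta> @ [s]"
        using \<beta> by (metis append_butlast_last_id)
      then show ?thesis
        using \<beta>(1) that by (metis (no_types, lifting) Un_iff empty_iff empty_set insert_iff
            le_eq_less_or_eq list.simps(15) set_append sorted_wrt_append)
    qed
    then show ?thesis
      using \<beta> by (auto simp: sorted_list_of_set.idem_if_sorted_distinct strict_sorted_iff)
  qed
  then have "step_seqs p k r s \<subseteq> sorted_list_of_set ` Pow {..s}"
    by blast
  then show ?thesis
    by (rule finite_subset) simp
qed


section \<open>Dominance\<close>

definition val_base :: "('a::field \<Rightarrow> real) \<Rightarrow> 'a \<Rightarrow> 'a \<Rightarrow> ereal" where
  "val_base absv mu x = (if x = 0 then \<infinity> else ereal (ln (absv x) / ln (absv mu)))"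

definition M_val ::
    "('a::field \<Rightarrow> real) \<Rightarrow> nat \<Rightarrow> (nat \<Rightarrow> 'a) \<Rightarrow> nat \<Rightarrow> nat \<Rightarrow> nat \<Rightarrow> ereal" where
  "M_val absv p a k r s =
     val_base absv (a 0 - 1) (psi p a k r s) / ereal (real (s - r))"

definition M_inf :: "('a::field \<Rightarrow> real) \<Rightarrow> nat \<Rightarrow> (nat \<Rightarrow> 'a) \<Rightarrow> nat \<Rightarrow> ereal" where
  "M_inf absv p a k = Inf {M_val absv p a k r s | r s. r < s \<and> p ^ k dvd r \<and> p ^ k dvd s}"

text \<open>The exponent \<open>\<tau> - 1\<close> is an integer, equal to \<open>-1\<close> when \<open>\<tau> = 0\<close>.\<close>

definition k_dominant ::
    "('a::field \<Rightarrow> real) \<Rightarrow> nat \<Rightarrow> (nat \<Rightarrow> 'a) \<Rightarrow> nat \<Rightarrow> bool" where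
  "k_dominant absv p a k \<longleftrightarrow>
     Min ((\<lambda>d. M_val absv p a k 0 (d * p ^ k)) ` {1..p - 1})
       \<le> Min (M_inf absv p a ` {0..k - 1}) - ereal (real p powi (int (exp_val p a) - 1))"

end

theory Submission
  imports Defs "HOL-Combinatorics.Multiset_Permutations" "HOL-Number_Theory.Number_Theory"
begin

text \<open>
  The coefficients of a linearization \<open>h(z) = z \<Sum> b\<^sub>n z\<^sup>n\<close> are sums of \<open>Phi\<close>-products over all chains
  from \<open>0\<close>; cutting the chains at the multiples of \<open>p\<^sup>k\<close> expresses them, and the \<open>psi\<close> of level \<open>k + 1\<close>,
  by the \<open>psi\<close> of level \<open>k\<close>. If \<open>f\<close> is \<open>k\<close>-dominant, then the least slope \<open>D\<close> of level \<open>k\<close> is attained at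
  a step \<open>d p\<^sup>k\<close> with \<open>d < p\<close>, lies at least \<open>p\<^bsup>\<tau>-1\<^esup>\<close> below the slopes of the lower levels, and up to
  terms of higher valuation \<open>psi k r (r + j p\<^sup>k)\<close> is a number \<open>c\<^sub>j\<close> independent of \<open>r\<close>, negligible for
  \<open>j \<ge> p\<close>.

  Hence the level \<open>k + 1\<close> chain sums are, to leading order, the solution \<open>B\<close> of \<open>w z B' = B C - T\<close>, where
  \<open>w = u / p\<^sup>\<tau>\<close> is prime to \<open>p\<close>,
  \<open>C = \<Sum> c\<^sub>j z\<^sup>j\<close> has degree less than \<open>p\<close> and \<open>T\<close>, a series in \<open>z\<^sup>p\<close>, collects the leading terms of the
  new \<open>psi\<close>. In characteristic \<open>p\<close> the coefficients of a logarithmic derivative \<open>L = z B' / B\<close> satisfy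
  \<open>L\<^sub>p\<^sub>n = L\<^sub>n\<^sup>p\<close>. As \<open>L\<^sub>d\<close> has leading term \<open>c\<^sub>d / w\<close> while \<open>C\<close> has no term of degree \<open>p d\<close>, some \<open>T\<^sub>p\<^sub>e\<close> with
  \<open>1 \<le> e \<le> d\<close> has minimal valuation, which makes \<open>f\<close> also \<open>(k + 1)\<close>-dominant. So the slopes tend to
  \<open>-\<infinity>\<close>, and the coefficients of \<open>h\<close> grow faster than any geometric sequence.
\<close>

section \<open>Multinomial sums and the recursions for the chain sums\<close>

lemma prod_list_map_eq_prod_count_list:
  fixes h :: "'b \<Rightarrow> 'a::comm_monoid_mult"
  assumes "set xs \<subseteq> X" "finite X"
  shows "prod_list (map h xs) = (\<Prod>x\<in>X. h x ^ count_list xs x)"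
  using assms
proof (induction xs)
  case (Cons y ys)
  then have *: "h y = (\<Prod>x\<in>X. if x = y then h y else 1)"
    by simp
  have "prod_list (map h (y # ys)) = h y * (\<Prod>x\<in>X. h x ^ count_list ys x)"
    using Cons by simp
  also have "\<dots> = (\<Prod>x\<in>X. (if x = y then h y else 1) * h x ^ count_list ys x)"
    by (subst *) (simp only: prod.distrib)
  also have "\<dots> = (\<Prod>x\<in>X. h x ^ count_list (y # ys) x)"
    by (intro prod.cong) auto
  finally show ?case .
qed simp

text \<open>The lists with counts \<open>\<alpha>\<close> are the permutations of one multiset; the
  two sum conditions give all of them length \<open>n\<close> and sum \<open>d\<close>.\<close>

lemma multinom_eq_card_natpermute:
  assumes sup: "\<And>i. i > d \<Longrightarrow> \<alpha> i = 0" and sz: "(\<Sum>i=0..d. \<alpha> i) = n"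
    and wt: "(\<Sum>i=1..d. i * \<alpha> i) = d"
  shows "card {v \<in> natpermute d n. count_list v = \<alpha>} = multinom n \<alpha> d"
proof -
  define A where "A = Abs_multiset \<alpha>"
  have "finite {x. \<alpha> x > 0}"
    by (rule finite_subset[of _ "{0..d}"]) (use sup in \<open>auto simp: not_less[symmetric] intro: ccontr\<close>)
  then have cA: "count A = \<alpha>"
    by (simp add: A_def)
  have setA: "set_mset A \<subseteq> {0..d}"
    using sup cA by (metis atLeastAtMost_iff le0 not_in_iff not_le_imp_less subsetI)
  have "{v \<in> natpermute d n. count_list v = \<alpha>} = permutations_of_multiset A"
  proof (intro Set.set_eqI iffI)
    fix v assume "v \<in> {v \<in> natpermute d n. count_list v = \<alpha>}"
    then show "v \<in> permutations_of_multiset A"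
      by (auto simp: permutations_of_multiset_def multiset_eq_iff cA count_mset)
  next
    fix v assume v: "v \<in> permutations_of_multiset A"
    then have mv: "mset v = A" by (simp add: permutations_of_multiset_def)
    then have c: "count_list v = \<alpha>"
      using cA by (auto simp: fun_eq_iff simp flip: count_mset)
    have "set v \<subseteq> {0..d}"
      using mv setA by (metis set_mset_mset)
    note this[THEN sum_list_map_eq_sum_count2]
    from this[of "\<lambda>_. 1"] this[of "\<lambda>x. x"]
    have "length v = n" "sum_list v = (\<Sum>i=0..d. i * \<alpha> i)"
      using c sz by (simp_all add: sum_list_triv mult.commute)
    moreover have "(\<Sum>i=0..d. i * \<alpha> i) = d"
      using wt by (simp add: sum.atLeast_Suc_atMost)
    ultimately show "v \<in> {v \<in> natpermute d n. count_list v = \<alpha>}"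
      using c by (auto simp: natpermute_def)
  qed
  moreover have "(\<Prod>x\<in>set_mset A. fact (count A x)) = (\<Prod>i=0..d. fact (\<alpha> i) :: nat)"
    by (rule prod.mono_neutral_cong_left) (use setA cA in \<open>auto simp: not_in_iff\<close>)
  moreover have "sum \<alpha> (set_mset A) = sum \<alpha> {0..d}"
    by (rule sum.mono_neutral_left) (use setA cA in \<open>auto simp: not_in_iff\<close>)
  then have "size A = n"
    using sz cA by (simp add: size_multiset_overloaded_eq)
  ultimately show ?thesis
    by (simp add: card_permutations_of_multiset multinom_def)
qed

text \<open>Expanding the power gives a sum over lists of exponents; grouping the lists by their
  counts yields the multinomial formula. With \<open>u = 1\<close>, \<open>multi_indices\<close>
  imposes no divisibility.\<close>

lemma fps_power_nth_multi_indices: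
  fixes a :: "nat \<Rightarrow> 'a::field"
  assumes "r \<le> s"
  shows "fps_nth (Abs_fps a ^ (r + 1)) (s - r) =
    (\<Sum>\<alpha>\<in>multi_indices 1 r s. of_nat (multinom (r + 1) \<alpha> (s - r)) * (\<Prod>i=0..s - r. a i ^ \<alpha> i))"
proof -
  define d n where "d = s - r" and "n = r + 1"
  have len: "length v = n" and sub: "set v \<subseteq> {0..d}" if "v \<in> natpermute d n" for v
    using that member_le_sum_list[of _ v] by (auto simp: natpermute_def)
  have cnt: "count_list v \<in> multi_indices 1 r s" if v: "v \<in> natpermute d n" for v
  proof -
    note sub[OF v, THEN sum_list_map_eq_sum_count2]
    from this[of "\<lambda>_. 1"] this[of "\<lambda>x. x"]
    have "(\<Sum>i=0..d. count_list v i) = n" "(\<Sum>i=0..d. i * count_list v i) = d"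
      using v len[OF v] by (simp_all add: sum_list_triv natpermute_def mult.commute)
    moreover have "count_list v i = 0" if "i > d" for i
      using sub[OF v] that by (auto simp: count_list_0_iff)
    ultimately show ?thesis
      by (auto simp: multi_indices_def d_def n_def sum.atLeast_Suc_atMost)
  qed
  have "fps_nth (Abs_fps a ^ (r + 1)) d = (\<Sum>v\<in>natpermute d n. \<Prod>j=0..r. a (v ! j))"
    by (simp add: fps_power_nth_Suc n_def del: power_Suc)
  also have "\<dots> = (\<Sum>v\<in>natpermute d n. \<Prod>i=0..d. a i ^ count_list v i)"
  proof (rule sum.cong)
    fix v assume v: "v \<in> natpermute d n"
    have "(\<Prod>j=0..r. a (v ! j)) = prod_list (map a v)"
      using len[OF v] by (simp add: prod.list_conv_set_nth n_def atLeastLessThanSuc_atLeastAtMost)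
    then show "(\<Prod>j=0..r. a (v ! j)) = (\<Prod>i=0..d. a i ^ count_list v i)"
      using prod_list_map_eq_prod_count_list[OF sub[OF v], of a] by simp
  qed simp
  also have "\<dots> = (\<Sum>\<alpha>\<in>multi_indices 1 r s. \<Sum>v\<in>{v \<in> natpermute d n. count_list v = \<alpha>}.
      \<Prod>i=0..d. a i ^ count_list v i)"
    by (rule sum.group[symmetric]) (use cnt in \<open>auto simp: natpermute_finite finite_multi_indices\<close>)
  also have "\<dots> = (\<Sum>\<alpha>\<in>multi_indices 1 r s. of_nat (multinom n \<alpha> d) * (\<Prod>i=0..d. a i ^ \<alpha> i))"
  proof (rule sum.cong)
    fix \<alpha> assume "\<alpha> \<in> multi_indices 1 r s"
    then have "card {v \<in> natpermute d n. count_list v = \<alpha>} = multinom n \<alpha> d"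
      by (intro multinom_eq_card_natpermute) (auto simp: multi_indices_def d_def n_def)
    moreover have "(\<Sum>v\<in>{v \<in> natpermute d n. count_list v = \<alpha>}. \<Prod>i=0..d. a i ^ count_list v i) =
        (\<Sum>v\<in>{v \<in> natpermute d n. count_list v = \<alpha>}. \<Prod>i=0..d. a i ^ \<alpha> i)"
      by (rule sum.cong) auto
    ultimately show "(\<Sum>v\<in>{v \<in> natpermute d n. count_list v = \<alpha>}. \<Prod>i=0..d. a i ^ count_list v i) =
        of_nat (multinom n \<alpha> d) * (\<Prod>i=0..d. a i ^ \<alpha> i)"
      by simp
  qed simp
  finally show ?thesis
    by (simp add: d_def n_def)
qed

lemma exp_gcd_dvd: "a i \<noteq> 0 \<Longrightarrow> exp_gcd a dvd i"
  by (cases "i = 0") (auto simp: exp_gcd_def intro!: Gcd_dvd)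

text \<open>A multi-index that uses an \<open>i\<close> not divisible by \<open>exp_gcd a\<close>
  contributes a factor \<open>a i = 0\<close>, so the restricted sum is the full expansion.\<close>

lemma Phi_eq_fps_power_nth:
  fixes a :: "nat \<Rightarrow> 'a::field"
  assumes "r \<le> s"
  shows "Phi a r s = fps_nth (Abs_fps a ^ (r + 1)) (s - r) / (a 0 * (1 - a 0 ^ s))"
proof -
  have sub: "multi_indices (exp_gcd a) r s \<subseteq> multi_indices 1 r s"
    by (auto simp: multi_indices_def)
  have "(\<Prod>i=0..s - r. a i ^ \<alpha> i) = 0" if "\<alpha> \<in> multi_indices 1 r s - multi_indices (exp_gcd a) r s" for \<alpha>
  proof -
    from that obtain i where i: "\<not> exp_gcd a dvd i" "\<alpha> i \<noteq> 0"
      by (auto simp: multi_indices_def)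
    have "i \<le> s - r"
      using i that by (auto simp: multi_indices_def intro: ccontr)
    moreover have "a i = 0" using i exp_gcd_dvd by blast
    ultimately show ?thesis
      using i by (auto intro!: prod_zero bexI[of _ i])
  qed
  then show ?thesis
    unfolding Phi_def fps_power_nth_multi_indices[OF assms]
    by (subst sum.mono_neutral_left[OF finite_multi_indices sub]) auto
qed

text \<open>A chain is either the single step from \<open>r\<close> to \<open>s\<close> or has a
  last interior point \<open>t\<close>; removing its final step leaves a chain from \<open>r\<close>
  to \<open>t\<close>.\<close>

lemma phi_rec:
  assumes "r < s"
  shows "phi p a k r s = Phi a (exp_gcd a * r) (exp_gcd a * s) +
    (\<Sum>t\<in>{r<..<s} \<inter> {t. \<not> p ^ k dvd t}. phi p a k r t * Phi a (exp_gcd a * t) (exp_gcd a * s))"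
proof -
  define T where "T = {r<..<s} \<inter> {t. \<not> p ^ k dvd t}"
  define F where "F t = (\<lambda>\<beta>. \<beta> @ [s]) ` step_seqs p k r t" for t
  have eq: "step_seqs p k r s = {[r, s]} \<union> (\<Union>t\<in>T. F t)"
  proof (intro Set.set_eqI iffI)
    fix \<beta> assume \<beta>: "\<beta> \<in> step_seqs p k r s"
    then have "\<beta> \<noteq> []" "last \<beta> = s" by (auto simp: step_seqs_def)
    then obtain \<gamma> where \<gamma>: "\<beta> = \<gamma> @ [s]" by (metis append_butlast_last_id)
    then have "\<gamma> \<noteq> []" using \<beta> by (auto simp: step_seqs_def)
    have hd: "hd \<gamma> = r" using \<beta> \<gamma> \<open>\<gamma> \<noteq> []\<close> by (simp add: step_seqs_def)
    show "\<beta> \<in> {[r, s]} \<union> (\<Union>t\<in>T. F t)"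
    proof (cases "length \<gamma> = 1")
      case True
      then have "\<gamma> = [r]" using hd by (cases \<gamma>) auto
      then show ?thesis using \<gamma> by simp
    next
      case False
      with \<open>\<gamma> \<noteq> []\<close> have len: "length \<gamma> \<ge> 2" by (cases \<gamma>) (auto simp: Suc_le_eq)
      have int: "\<not> p ^ k dvd \<gamma> ! j" if "1 \<le> j" "j \<le> length \<gamma> - 1" for j
      proof -
        have "j \<le> length \<beta> - 2" using that \<gamma> len by simp
        then have "\<not> p ^ k dvd \<beta> ! j" using \<beta> that(1) by (simp add: step_seqs_def)
        moreover have "j < length \<gamma>" using that len by linarith
        ultimately show ?thesis using \<gamma> by (simp add: nth_append)
      qed
      have srt: "sorted_wrt (<) \<gamma>" and lt: "\<forall>x\<in>set \<gamma>. x < s"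
        using \<beta> \<gamma> by (auto simp: step_seqs_def sorted_wrt_append)
      have last: "last \<gamma> = \<gamma> ! (length \<gamma> - 1)" using \<open>\<gamma> \<noteq> []\<close> by (simp add: last_conv_nth)
      have "\<gamma> ! 0 < \<gamma> ! (length \<gamma> - 1)"
        using sorted_wrt_nth_less[OF srt, of 0 "length \<gamma> - 1"] len by simp
      then have "r < last \<gamma>" using last hd \<open>\<gamma> \<noteq> []\<close> by (simp add: hd_conv_nth)
      moreover have "last \<gamma> < s" using lt \<open>\<gamma> \<noteq> []\<close> by simp
      ultimately have "last \<gamma> \<in> T" using int[of "length \<gamma> - 1"] len last by (auto simp: T_def)
      moreover have "\<gamma> \<in> step_seqs p k r (last \<gamma>)"
        using len srt hd int by (auto simp: step_seqs_def)
      ultimately show ?thesis using \<gamma> by (auto simp: F_def)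
    qed
  next
    fix \<beta> assume "\<beta> \<in> {[r, s]} \<union> (\<Union>t\<in>T. F t)"
    then consider "\<beta> = [r, s]" | t \<gamma> where "t \<in> T" "\<gamma> \<in> step_seqs p k r t" "\<beta> = \<gamma> @ [s]"
      by (auto simp: F_def)
    then show "\<beta> \<in> step_seqs p k r s"
    proof cases
      case 1
      then show ?thesis using assms by (auto simp: step_seqs_def)
    next
      case 2
      then have g: "\<gamma> \<noteq> []" "last \<gamma> = t" "sorted_wrt (<) \<gamma>" "length \<gamma> \<ge> 2" "hd \<gamma> = r"
        by (auto simp: step_seqs_def)
      have t: "t < s" "\<not> p ^ k dvd t" using 2 by (auto simp: T_def)
      have "x \<le> t" if "x \<in> set \<gamma>" for x
      proof -
        have "\<gamma> = butlast \<gamma> @ [t]" using g by (metis append_butlast_last_id)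
        then have "sorted_wrt (<) (butlast \<gamma> @ [t])" "x \<in> set (butlast \<gamma> @ [t])"
          using g that by auto
        then show ?thesis by (auto simp: sorted_wrt_append less_imp_le)
      qed
      then have "\<forall>x\<in>set \<gamma>. x < s" using t by force
      moreover have "\<not> p ^ k dvd \<beta> ! j" if "1 \<le> j" "j \<le> length \<beta> - 2" for j
      proof (cases "j = length \<gamma> - 1")
        case True
        then have "\<beta> ! j = last \<gamma>" using 2 g by (simp add: nth_append last_conv_nth)
        then show ?thesis using t g by simp
      next
        case False
        then show ?thesis using 2 that g by (auto simp: step_seqs_def nth_append)
      qed
      ultimately show ?thesis
        using 2 g by (auto simp: step_seqs_def sorted_wrt_append)
    qed
  qed
  have last: "last \<gamma> = t" "length \<gamma> \<ge> 2" if "\<gamma> \<in> step_seqs p k r t" for \<gamma> t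
    using that by (auto simp: step_seqs_def)
  have Phi_app: "Phi_seq a (\<gamma> @ [s]) = Phi_seq a \<gamma> * Phi a (exp_gcd a * t) (exp_gcd a * s)"
    if *: "\<gamma> \<in> step_seqs p k r t" for \<gamma> t
  proof -
    obtain m where m: "length \<gamma> = Suc (Suc m)"
      using last(2)[OF *] by (metis add_2_eq_Suc le_Suc_ex)
    then have "\<gamma> \<noteq> []" by auto
    then have "\<gamma> ! Suc m = t" using last(1)[OF *] m by (simp add: last_conv_nth)
    moreover have "(\<Prod>j=0..m. Phi a (exp_gcd a * (\<gamma> @ [s]) ! j) (exp_gcd a * (\<gamma> @ [s]) ! (j + 1)))
       = (\<Prod>j=0..m. Phi a (exp_gcd a * \<gamma> ! j) (exp_gcd a * \<gamma> ! (j + 1)))"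
      using m by (intro prod.cong) (auto simp: nth_append)
    ultimately show ?thesis
      using m by (simp add: Phi_seq_def nth_append)
  qed
  have "phi p a k r s = (\<Sum>\<beta>\<in>{[r, s]}. Phi_seq a \<beta>) + (\<Sum>\<beta>\<in>(\<Union>t\<in>T. F t). Phi_seq a \<beta>)"
    unfolding phi_def eq
  proof (rule sum.union_disjoint)
    show "finite (\<Union>t\<in>T. F t)"
      by (auto simp: F_def T_def finite_step_seqs)
    show "{[r, s]} \<inter> (\<Union>t\<in>T. F t) = {}"
      using last(2) by (fastforce simp: F_def)
  qed simp
  also have "(\<Sum>\<beta>\<in>{[r, s]}. Phi_seq a \<beta>) = Phi a (exp_gcd a * r) (exp_gcd a * s)"
    by (simp add: Phi_seq_def)
  also have "(\<Sum>\<beta>\<in>(\<Union>t\<in>T. F t). Phi_seq a \<beta>) = (\<Sum>t\<in>T. \<Sum>\<beta>\<in>F t. Phi_seq a \<beta>)"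
    using last(1) by (intro sum.UNION_disjoint) (auto simp: F_def T_def finite_step_seqs)
  also have "\<dots> = (\<Sum>t\<in>T. phi p a k r t * Phi a (exp_gcd a * t) (exp_gcd a * s))"
  proof (rule sum.cong)
    fix t
    have "inj_on (\<lambda>\<beta>. \<beta> @ [s]) (step_seqs p k r t)"
      by (auto simp: inj_on_def)
    then show "(\<Sum>\<beta>\<in>F t. Phi_seq a \<beta>) = phi p a k r t * Phi a (exp_gcd a * t) (exp_gcd a * s)"
      by (simp add: F_def sum.reindex phi_def sum_distrib_right Phi_app)
  qed simp
  finally show ?thesis by (simp add: T_def)
qed

text \<open>For chains with step weights \<open>W\<close>, \<open>X\<close> admits interior points
  in \<open>B\<close> and \<open>Y\<close> only those in \<open>A\<close>; a \<open>B\<close>-chain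
  is cut at its last point in \<open>B - A\<close>. For \<open>X\<close> only the recursion is
  assumed, so it may also be the coefficient sequence of a linearization.\<close>

lemma renewal_refine:
  fixes X :: "nat \<Rightarrow> 'a::comm_ring_1"
  assumes X: "\<And>s. r < s \<Longrightarrow> X s = W r s + (\<Sum>t\<in>{r<..<s} \<inter> B. X t * W t s)"
    and Y: "\<And>r s. r < s \<Longrightarrow> Y r s = W r s + (\<Sum>t\<in>{r<..<s} \<inter> A. Y r t * W t s)"
    and AB: "A \<subseteq> B" and rs: "r < s"
  shows "X s = Y r s + (\<Sum>t\<in>{r<..<s} \<inter> (B - A). X t * Y t s)"
  using rs
proof (induction s rule: less_induct)
  case (less s)
  let ?S = "{r<..<s}" and ?D = "B - A"
  have ev: "(\<Sum>t\<in>?S \<inter> A. (\<Sum>i\<in>{r<..<t} \<inter> ?D. X i * Y i t) * W t s)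
      = (\<Sum>i\<in>?S \<inter> ?D. \<Sum>t\<in>{i<..<s} \<inter> A. X i * (Y i t * W t s))"
  proof -
    have "(\<Sum>t\<in>?S \<inter> A. (\<Sum>i\<in>{r<..<t} \<inter> ?D. X i * Y i t) * W t s)
        = (\<Sum>t\<in>?S \<inter> A. \<Sum>i | i \<in> ?S \<inter> ?D \<and> i < t. X i * (Y i t * W t s))"
      by (intro sum.cong) (auto simp: sum_distrib_right mult.assoc intro!: sum.cong)
    also have "\<dots> = (\<Sum>i\<in>?S \<inter> ?D. \<Sum>t | t \<in> ?S \<inter> A \<and> i < t. X i * (Y i t * W t s))"
      by (rule sum.swap_restrict) auto
    also have "\<dots> = (\<Sum>i\<in>?S \<inter> ?D. \<Sum>t\<in>{i<..<s} \<inter> A. X i * (Y i t * W t s))"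
      by (intro sum.cong) auto
    finally show ?thesis .
  qed
  have "X s = W r s + (\<Sum>t\<in>?S \<inter> B. X t * W t s)"
    using X less.prems by blast
  also have "?S \<inter> B = (?S \<inter> A) \<union> (?S \<inter> ?D)"
    using AB by auto
  also have "(\<Sum>t\<in>(?S \<inter> A) \<union> (?S \<inter> ?D). X t * W t s)
      = (\<Sum>t\<in>?S \<inter> A. X t * W t s) + (\<Sum>t\<in>?S \<inter> ?D. X t * W t s)"
    by (rule sum.union_disjoint) auto
  also have "(\<Sum>t\<in>?S \<inter> A. X t * W t s)
      = (\<Sum>t\<in>?S \<inter> A. Y r t * W t s + (\<Sum>i\<in>{r<..<t} \<inter> ?D. X i * Y i t) * W t s)"
    by (rule sum.cong) (auto simp: less.IH algebra_simps)
  also have "\<dots> = (\<Sum>t\<in>?S \<inter> A. Y r t * W t s) +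
      (\<Sum>i\<in>?S \<inter> ?D. X i * (\<Sum>t\<in>{i<..<s} \<inter> A. Y i t * W t s))"
    by (simp only: sum.distrib ev sum_distrib_left)
  also have "W r s + ((\<Sum>t\<in>?S \<inter> A. Y r t * W t s) +
      (\<Sum>i\<in>?S \<inter> ?D. X i * (\<Sum>t\<in>{i<..<s} \<inter> A. Y i t * W t s)) + (\<Sum>t\<in>?S \<inter> ?D. X t * W t s))
     = Y r s + ((\<Sum>i\<in>?S \<inter> ?D. X i * W i s + X i * (\<Sum>t\<in>{i<..<s} \<inter> A. Y i t * W t s)))"
    by (subst Y[OF less.prems]) (simp add: sum.distrib algebra_simps)
  also have "(\<Sum>i\<in>?S \<inter> ?D. X i * W i s + X i * (\<Sum>t\<in>{i<..<s} \<inter> A. Y i t * W t s))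
     = (\<Sum>i\<in>?S \<inter> ?D. X i * Y i s)"
    by (rule sum.cong) (auto simp: Y algebra_simps)
  finally show ?case .
qed


section \<open>Logarithmic derivatives in characteristic p\<close>

definition fps_log_deriv :: "'a::field fps \<Rightarrow> 'a fps" where
  "fps_log_deriv B = fps_X * fps_deriv B * inverse B"

lemma fps_X_times_deriv_nth: "fps_nth (fps_X * fps_deriv B) n = of_nat n * fps_nth B n"
  by (cases n) auto

lemma fps_log_derivI:
  assumes "fps_nth B 0 \<noteq> 0" "B * L = fps_X * fps_deriv B"
  shows "fps_log_deriv B = L"
  using assms inverse_mult_eq_1[of B] unfolding fps_log_deriv_def
  by (metis mult.assoc mult.commute mult.left_neutral)

lemma fps_log_deriv_mult_eq: "fps_nth B 0 \<noteq> 0 \<Longrightarrow> B * fps_log_deriv B = fps_X * fps_deriv B"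
  using inverse_mult_eq_1[of B] unfolding fps_log_deriv_def
  by (metis mult.assoc mult.commute mult.left_neutral)

lemma fps_log_deriv_mult:
  assumes "fps_nth B 0 \<noteq> 0" "fps_nth C 0 \<noteq> 0"
  shows "fps_log_deriv (B * C) = fps_log_deriv B + fps_log_deriv C"
proof (rule fps_log_derivI)
  have "(B * C) * (fps_log_deriv B + fps_log_deriv C)
      = (B * fps_log_deriv B) * C + B * (C * fps_log_deriv C)"
    by (simp add: algebra_simps)
  then show "(B * C) * (fps_log_deriv B + fps_log_deriv C) = fps_X * fps_deriv (B * C)"
    by (simp add: fps_log_deriv_mult_eq assms algebra_simps)
qed (use assms in simp)

text \<open>The geometric series of \<open>- n t z^n / (1 - t z^n)\<close>, verified by multiplying
  back with the denominator.\<close>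

lemma fps_log_deriv_binomial_nth:
  assumes "n \<ge> 1"
  shows "fps_nth (fps_log_deriv (1 - fps_const t * fps_X ^ n)) N =
    (if n dvd N \<and> N > 0 then - of_nat n * t ^ (N div n) else 0)"
proof -
  define S where "S = Abs_fps (\<lambda>N. if n dvd N \<and> N > 0 then - of_nat n * t ^ (N div n) else 0)"
  have "fps_nth ((1 - fps_const t * fps_X ^ n) * S) N =
      fps_nth (fps_X * fps_deriv (1 - fps_const t * fps_X ^ n)) N" for N
  proof -
    have l: "fps_nth ((1 - fps_const t * fps_X ^ n) * S) N
        = fps_nth S N - t * (if N < n then 0 else fps_nth S (N - n))"
    proof -
      have "(1 - fps_const t * fps_X ^ n) * S = S - fps_const t * (fps_X ^ n * S)"
        by (simp add: algebra_simps)
      then show ?thesis by (simp add: fps_X_power_mult_nth)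
    qed
    have r: "fps_nth (fps_X * fps_deriv (1 - fps_const t * fps_X ^ n)) N
        = (if N = n then - of_nat n * t else 0)"
      using assms unfolding fps_X_times_deriv_nth by (auto simp: fps_X_power_nth)
    show ?thesis
    proof (cases "n dvd N \<and> N > 0")
      case True
      then obtain m where m: "N = n * m" "m > 0" by (auto elim!: dvdE)
      show ?thesis
      proof (cases "m = 1")
        case True
        then show ?thesis unfolding l r using m assms by (simp add: S_def)
      next
        case False
        then obtain j where j: "m = Suc (Suc j)"
          using m by (metis One_nat_def Suc_pred neq0_conv)
        have "N - n = n * Suc j" "\<not> N < n" "N \<noteq> n" using m j assms by auto
        then show ?thesis unfolding l r using m assms
          by (simp add: S_def j)
      qed
    next
      case False
      then show ?thesis unfolding l r using assms
        by (auto simp: S_def dvd_diff_nat dvd_minus_self)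
    qed
  qed
  then have "fps_log_deriv (1 - fps_const t * fps_X ^ n) = S"
    using assms by (intro fps_log_derivI fps_ext) auto
  then show ?thesis by (simp add: S_def)
qed

lemma of_nat_power_CHAR:
  assumes "prime p" "CHAR('a::field) = p"
  shows "(of_nat n :: 'a) ^ p = of_nat n"
proof (cases "p dvd n")
  case True
  then have "(of_nat n :: 'a) = 0" using assms by (simp add: of_nat_eq_0_iff_char_dvd)
  then show ?thesis using assms prime_gt_0_nat by simp
next
  case False
  then have "[n ^ (p - 1) = 1] (mod p)" using fermat_theorem assms by blast
  then have "(of_nat (n ^ (p - 1)) :: 'a) = of_nat 1"
    unfolding of_nat_eq_iff_cong_CHAR assms .
  moreover have "p = Suc (p - 1)" using prime_gt_0_nat[OF assms(1)] by simp
  ultimately show ?thesis by (metis mult.right_neutral of_nat_1 of_nat_power power_Suc)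
qed

lemma minus_power_CHAR:
  assumes "prime p" "CHAR('a::field) = p"
  shows "(- x :: 'a) ^ p = - (x ^ p)"
proof -
  have "x ^ p + (- x) ^ p = (x + - x) ^ p"
    using freshmans_dream[of p x "- x"] assms by metis
  also have "\<dots> = 0" using prime_gt_0_nat[OF assms(1)] by simp
  finally show ?thesis by (metis add.inverse_unique)
qed

text \<open>If \<open>p\<close> divides \<open>n\<close>, all coefficients vanish with the factor
  \<open>n\<close>. Otherwise \<open>n\<close> divides \<open>p * N\<close> exactly when it divides
  \<open>N\<close>, and \<open>- of_nat n\<close> is fixed by Frobenius.\<close>

lemma fps_log_deriv_binomial_Frobenius:
  assumes "prime p" "CHAR('a::field) = p" "n \<ge> 1" "N \<ge> 1"
  shows "fps_nth (fps_log_deriv (1 - fps_const (t::'a) * fps_X ^ n)) (p * N) =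
    fps_nth (fps_log_deriv (1 - fps_const t * fps_X ^ n)) N ^ p"
proof (cases "p dvd n")
  case True
  then have "(of_nat n :: 'a) = 0" using assms by (simp add: of_nat_eq_0_iff_char_dvd)
  then show ?thesis
    using prime_gt_0_nat[OF assms(1)] by (simp add: fps_log_deriv_binomial_nth[OF assms(3)])
next
  case False
  then have "coprime n p" using assms(1) by (metis coprime_commute prime_imp_coprime)
  then have *: "n dvd p * N \<longleftrightarrow> n dvd N" by (simp add: coprime_dvd_mult_right_iff)
  have "t ^ (p * N div n) = (t ^ (N div n)) ^ p" if "n dvd N"
    using that by (simp add: div_mult_swap mult.commute flip: power_mult)
  then show ?thesis
    using prime_gt_0_nat[OF assms(1)] assms *
    by (auto simp: fps_log_deriv_binomial_nth[OF assms(3)] minus_power_CHAR power_mult_distrib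
        of_nat_power_CHAR)
qed

text \<open>
  Writing \<open>B\<close> as a product of factors \<open>1 - t X\<^sup>n\<close>, this is the Frobenius relation for the power
  sums of its reciprocal roots.
\<close>

lemma fps_log_deriv_Frobenius:
  fixes B :: "'a::field fps"
  assumes p: "prime p" "CHAR('a) = p" and B: "fps_nth B 0 = 1" and N: "N \<ge> 1"
  shows "fps_nth (fps_log_deriv B) (p * N) = fps_nth (fps_log_deriv B) N ^ p"
proof -
  \<comment> \<open>\<open>F\<close> collects the binomial factors split off so far; the remaining
    factor is 1 up to degree \<open>n\<close>.\<close>
  have "\<exists>F Y. fps_nth F 0 = 1 \<and> B = F * (1 + fps_X ^ Suc n * Y) \<and>
      (\<forall>N\<ge>1. fps_nth (fps_log_deriv F) (p * N) = fps_nth (fps_log_deriv F) N ^ p)" for n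
  proof (induction n)
    case 0
    define Y where "Y = fps_shift 1 (B - 1)"
    have "B = 1 + fps_X * Y"
      using B by (intro fps_ext) (auto simp: Y_def fps_X_mult_nth)
    moreover have "fps_log_deriv 1 = (0 :: 'a fps)"
      by (simp add: fps_log_deriv_def)
    ultimately show ?case
      using prime_gt_0_nat[OF p(1)] by (intro exI[of _ 1] exI[of _ Y]) auto
  next
    case (Suc n)
    then obtain F Y where F: "fps_nth F 0 = 1" and BF: "B = F * (1 + fps_X ^ Suc n * Y)"
      and FN: "\<And>N. N \<ge> 1 \<Longrightarrow> fps_nth (fps_log_deriv F) (p * N) = fps_nth (fps_log_deriv F) N ^ p"
      by blast
    \<comment> \<open>This makes the new factor \<open>G\<close> agree with the remaining one in
      degree \<open>n + 1\<close>.\<close>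
    define t where "t = - fps_nth Y 0"
    define G where "G = 1 - fps_const t * fps_X ^ Suc n"
    define Z where "Z = fps_shift 1 (Y + fps_const t) * inverse G"
    have G0: "fps_nth G 0 = 1" by (simp add: G_def)
    have "fps_X * fps_shift 1 (Y + fps_const t) = Y + fps_const t"
      by (intro fps_ext) (auto simp: fps_X_mult_nth t_def)
    moreover have "G * (fps_X ^ Suc (Suc n) * Z) = fps_X ^ Suc n * (fps_X * fps_shift 1 (Y + fps_const t)) * (G * inverse G)"
      by (simp add: Z_def algebra_simps)
    moreover have "G * inverse G = 1"
      using inverse_mult_eq_1'[of G] G0 by simp
    ultimately have "G * (1 + fps_X ^ Suc (Suc n) * Z) = 1 + fps_X ^ Suc n * Y"
      by (simp add: algebra_simps) (simp add: G_def algebra_simps)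
    then have "B = (F * G) * (1 + fps_X ^ Suc (Suc n) * Z)"
      by (simp add: BF mult.assoc)
    moreover have "fps_nth (fps_log_deriv (F * G)) (p * N) = fps_nth (fps_log_deriv (F * G)) N ^ p"
      if "N \<ge> 1" for N
      using that p FN[OF that] fps_log_deriv_binomial_Frobenius[OF p, of "Suc n" N t]
      by (simp add: fps_log_deriv_mult F G0 freshmans_dream flip: G_def del: power_Suc)
    ultimately show ?case using F G0 by (intro exI[of _ "F * G"] exI[of _ Z]) auto
  qed
  \<comment> \<open>After \<open>p * N\<close> steps the remaining factor cannot influence the
    coefficients up to degree \<open>p * N\<close>.\<close>
  from this[of "p * N"] obtain F Y where F: "fps_nth F 0 = 1"
    and BF: "B = F * (1 + fps_X ^ Suc (p * N) * Y)"
    and FN: "\<And>N. N \<ge> 1 \<Longrightarrow> fps_nth (fps_log_deriv F) (p * N) = fps_nth (fps_log_deriv F) N ^ p"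
    by blast
  define E where "E = 1 + fps_X ^ Suc (p * N) * Y"
  have E0: "fps_nth E 0 = 1" by (simp add: E_def fps_X_power_mult_nth del: power_Suc)
  have "fps_nth (fps_log_deriv E) i = 0" if "i \<le> p * N" for i
  proof -
    have "fps_nth (fps_X * fps_deriv E) j = 0" if "j \<le> i" for j
      using that \<open>i \<le> p * N\<close> unfolding fps_X_times_deriv_nth
      by (auto simp: E_def fps_X_power_mult_nth simp del: power_Suc)
    then show ?thesis by (simp add: fps_log_deriv_def fps_mult_nth)
  qed
  moreover have "N \<le> p * N" using prime_gt_0_nat[OF p(1)] by simp
  moreover have "fps_log_deriv B = fps_log_deriv F + fps_log_deriv E"
    using BF[folded E_def] F E0 by (simp add: fps_log_deriv_mult)
  ultimately show ?thesis using FN[OF N] by simp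
qed


section \<open>Ultrametric estimates\<close>

text \<open>Raising to a power \<open>p ^ e\<close> is additive, hence acts on each monomial
  separately; the constant terms are split off one at a time.\<close>

lemma fps_power_CHAR_power_nth:
  fixes F :: "'a::field fps"
  assumes "prime p" "CHAR('a) = p"
  shows "fps_nth (F ^ (p ^ e)) n = (if p ^ e dvd n then fps_nth F (n div p ^ e) ^ (p ^ e) else 0)"
proof (induction n arbitrary: F rule: less_induct)
  case (less n)
  define Q where "Q = p ^ e"
  have Q: "Q > 0" using prime_gt_0_nat[OF assms(1)] by (simp add: Q_def)
  define G where "G = fps_shift 1 F"
  have "F = fps_const (fps_nth F 0) + fps_X * G"
    by (intro fps_ext) (auto simp: G_def fps_X_mult_nth)
  then have "F ^ Q = (fps_const (fps_nth F 0) + fps_X * G) ^ Q"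
    by simp
  also have "\<dots> = fps_const (fps_nth F 0) ^ Q + (fps_X * G) ^ Q"
    using assms by (intro freshmans_dream') (auto simp: Q_def)
  finally have F: "F ^ Q = fps_const (fps_nth F 0 ^ Q) + fps_X ^ Q * G ^ Q"
    by (simp add: power_mult_distrib)
  show ?case
  proof (cases "n < Q")
    case True
    then show ?thesis using F Q
      by (auto simp: Q_def[symmetric] fps_X_power_mult_nth dest: dvd_imp_le)
  next
    case False
    then have n: "fps_nth (F ^ Q) n = fps_nth (G ^ Q) (n - Q)"
      using F Q by (simp add: fps_X_power_mult_nth)
    also have "\<dots> = (if Q dvd n - Q then fps_nth G ((n - Q) div Q) ^ Q else 0)"
      using less.IH[of "n - Q" G] False Q unfolding Q_def by linarith
    also have "Q dvd n - Q \<longleftrightarrow> Q dvd n"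
      using False by (simp add: dvd_minus_self)
    also have "fps_nth G ((n - Q) div Q) = fps_nth F (n div Q)"
      using False Q by (simp add: G_def le_div_geq)
    finally show ?thesis by (simp add: Q_def)
  qed
qed

context nonarch_field
begin

lemma absv_0 [simp]: "absv 0 = 0"
  by (simp add: absv_eq_0_iff)

lemma absv_power: "absv (x ^ n) = absv x ^ n"
  by (induction n) (simp_all add: absv_1 absv_mult)

lemma absv_inverse: "absv (inverse x) = inverse (absv x)"
proof (cases "x = 0")
  case False
  then have "absv x * absv (inverse x) = 1"
    by (simp add: absv_1 flip: absv_mult)
  then show ?thesis by (metis inverse_unique)
qed simp

lemma absv_divide: "absv (x / y) = absv x / absv y"
  by (simp add: divide_inverse absv_mult absv_inverse)

lemma absv_diff_le_max: "absv (x - y) \<le> max (absv x) (absv y)"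
  using absv_add_le_max[of x "- y"] by (simp add: absv_minus)

lemma absv_sum_le:
  assumes "\<And>i. i \<in> S \<Longrightarrow> absv (f i) \<le> B" "0 \<le> B"
  shows "absv (sum f S) \<le> B"
  using assms
proof (induction S rule: infinite_finite_induct)
  case (insert x S)
  then have "absv (f x) \<le> B" "absv (sum f S) \<le> B" by auto
  then show ?case
    using insert.hyps absv_add_le_max[of "f x" "sum f S"] by simp
qed auto

lemma absv_sum_less:
  assumes "\<And>i. i \<in> S \<Longrightarrow> absv (f i) < B" "0 < B"
  shows "absv (sum f S) < B"
  using assms
proof (induction S rule: infinite_finite_induct)
  case (insert x S)
  then have "absv (f x) < B" "absv (sum f S) < B" by auto
  then show ?case
    using insert.hyps absv_add_le_max[of "f x" "sum f S"] by simp
qed auto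

lemma absv_eq_of_diff_less:
  assumes "absv (x - y) < absv y"
  shows "absv x = absv y"
  using absv_add_le_max[of "x - y" y] absv_diff_le_max[of x "x - y"] assms by auto

end

section \<open>The setting of the theorem and the valuation scale\<close>

locale near_identity = nonarch_field absv for absv :: "'a::field \<Rightarrow> real" +
  fixes p :: nat and a :: "nat \<Rightarrow> 'a"
  assumes prime_p: "prime p" and CHAR_p: "CHAR('a) = p"
    and not_root_of_unity: "n \<ge> 1 \<Longrightarrow> a 0 ^ n \<noteq> 1"
    and near_1: "absv (1 - a 0) < 1"
    and nonlinear: "\<exists>n\<ge>1. a n \<noteq> 0"
begin

abbreviation lam :: 'a where "lam \<equiv> a 0"
abbreviation u :: nat where "u \<equiv> exp_gcd a"
abbreviation \<tau> :: nat where "\<tau> \<equiv> exp_val p a"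

text \<open>
  \<open>pw l\<close> is the valuation of \<open>1 - \<lambda> ^ (u * s)\<close> when \<open>p ^ l\<close> exactly divides \<open>s\<close>; and \<open>small x t\<close>
  says \<open>val\<^sub>\<mu> x \<ge> t\<close>, including \<open>x = 0\<close>.
\<close>

definition q :: real where "q = absv (lam - 1)"
definition pw :: "nat \<Rightarrow> real" where "pw l = real (p ^ (l + \<tau>))"
definition small :: "'a \<Rightarrow> real \<Rightarrow> bool" where "small x t \<longleftrightarrow> absv x \<le> q powr t"

lemma p_gt_0: "p > 0" and p_gt_1: "p > 1"
  using prime_p prime_gt_0_nat prime_gt_1_nat by auto

lemma q_pos: "q > 0" and q_less_1: "q < 1"
proof -
  have "lam \<noteq> 1" using not_root_of_unity[of 1] by simp
  then show "q > 0" using absv_nonneg[of "lam - 1"] by (auto simp: q_def absv_eq_0_iff less_le)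
  show "q < 1" using near_1 absv_minus[of "lam - 1"] by (simp add: q_def)
qed

lemma absv_lam: "absv lam = 1"
  using absv_eq_of_diff_less[of lam 1] q_less_1 by (simp add: q_def absv_1)

lemma lam_nonzero: "lam \<noteq> 0"
  using absv_lam by auto

lemma absv_lam_power: "absv (lam ^ n) = 1"
  by (simp add: absv_power absv_lam)

lemma pw_pos: "pw l \<ge> 1" and pw_Suc: "pw (Suc l) = p * pw l"
  using p_gt_0 by (simp_all add: pw_def Suc_leI)

lemma q_powr_le_iff: "q powr s \<le> q powr t \<longleftrightarrow> t \<le> s"
  using q_pos q_less_1 by (simp add: powr_def)

lemma q_powr_less_iff: "q powr s < q powr t \<longleftrightarrow> t < s"
  using q_pos q_less_1 by (simp add: powr_def)

lemma small_mono: "small x t \<Longrightarrow> s \<le> t \<Longrightarrow> small x s"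
  using q_powr_le_iff[of t s] by (auto simp: small_def)

lemma small_0: "small 0 t"
  by (simp add: small_def)

lemma small_mult: "small x s \<Longrightarrow> small y t \<Longrightarrow> r \<le> s + t \<Longrightarrow> small (x * y) r"
  by (rule small_mono[of _ "s + t"])
    (auto simp: small_def absv_mult powr_add intro!: mult_mono absv_nonneg)

lemma small_add: "small x t \<Longrightarrow> small y t \<Longrightarrow> small (x + y) t"
  using absv_add_le_max[of x y] by (auto simp: small_def)

lemma small_diff: "small x t \<Longrightarrow> small y t \<Longrightarrow> small (x - y) t"
  using absv_diff_le_max[of x y] by (auto simp: small_def)

lemma small_sum: "(\<And>i. i \<in> S \<Longrightarrow> small (f i) t) \<Longrightarrow> small (sum f S) t"
  unfolding small_def by (rule absv_sum_le) auto

lemma small_minus_commute: "small (x - y) t \<longleftrightarrow> small (y - x) t"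
  using absv_minus[of "x - y"] by (simp add: small_def)

lemma small_absv_1: "absv x \<le> 1 \<Longrightarrow> small x 0"
  using q_pos by (simp add: small_def)

lemma small_unit_mult: "absv x = 1 \<Longrightarrow> small (x * y) t \<longleftrightarrow> small y t"
  by (simp add: small_def absv_mult)

lemma small_divide: "small x s \<Longrightarrow> absv y = q powr t \<Longrightarrow> r \<le> s - t \<Longrightarrow> small (x / y) r"
  using q_pos by (intro small_mono[of _ "s - t" r])
    (auto simp: small_def absv_divide powr_diff intro: divide_right_mono)

lemma small_power:
  assumes "small x t" "s \<le> real n * t"
  shows "small (x ^ n) s"
proof -
  have "absv x ^ n \<le> (q powr t) ^ n"
    using assms(1) absv_nonneg by (auto simp: small_def intro: power_mono)
  also have "\<dots> = q powr (real n * t)"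
    using q_pos by (simp add: powr_powr mult.commute flip: powr_realpow)
  finally show ?thesis
    using assms(2) by (intro small_mono[of _ "real n * t" s]) (auto simp: small_def absv_power)
qed

section \<open>Sizes of the small divisors\<close>

lemma u_pos: "u > 0"
proof -
  obtain n where "n \<ge> 1" "a n \<noteq> 0" using nonlinear by blast
  then show ?thesis using exp_gcd_dvd[of a n] by (metis dvd_0_left_iff gr0I not_one_le_zero)
qed

lemma u_decomp: obtains w where "u = p ^ \<tau> * w" "\<not> p dvd w"
  using multiplicity_decompose'[of u p thesis] u_pos prime_p p_gt_1 by (simp add: exp_val_def)

text \<open>By Fermat such an integer is a \<open>(p - 1)\<close>-th root of unity in the
  field.\<close>

lemma absv_of_nat: "\<not> p dvd n \<Longrightarrow> absv (of_nat n) = 1"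
proof -
  assume "\<not> p dvd n"
  then have "(of_nat n :: 'a) \<noteq> 0" by (simp add: of_nat_eq_0_iff_char_dvd CHAR_p)
  moreover have "(of_nat n :: 'a) ^ p = of_nat n" by (rule of_nat_power_CHAR[OF prime_p CHAR_p])
  moreover have "(of_nat n :: 'a) ^ p = of_nat n * of_nat n ^ (p - 1)"
    using p_gt_0 by (simp add: power_eq_if)
  ultimately have "(of_nat n :: 'a) ^ (p - 1) = 1"
    by (metis mult_cancel_left1)
  then have "absv (of_nat n) ^ (p - 1) = 1"
    by (metis absv_1 absv_power)
  then show ?thesis
    using p_gt_1 absv_nonneg[of "of_nat n"]
    by (intro power_eq_imp_eq_base[of "absv (of_nat n)" "p - 1" 1]) auto
qed

lemma small_one_minus_lam_power: "small (1 - lam ^ n) 1"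
proof -
  have "1 - lam ^ n = (1 - lam) * (\<Sum>i<n. lam ^ i)"
    by (rule one_diff_power_eq)
  moreover have "small (1 - lam) 1"
    using q_pos absv_minus[of "1 - lam"] by (simp add: small_def q_def)
  moreover have "small (\<Sum>i<n. lam ^ i) 0"
    by (intro small_absv_1 absv_sum_le) (auto simp: absv_lam_power)
  ultimately show ?thesis by (auto intro: small_mult)
qed

text \<open>Powers of \<open>lam\<close> are 1 up to valuation 1, so \<open>m\<close> of them add up
  to about \<open>m\<close>. For \<open>m\<close> prime to \<open>p\<close> the sum is therefore a
  unit, and \<open>1 - x ^ m\<close> with \<open>x = lam ^ n\<close> is as large as
  \<open>1 - x\<close>.\<close>

lemma small_geometric: "small ((\<Sum>i<m. (lam ^ n) ^ i) - of_nat m) 1"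
proof -
  have "(\<Sum>i<m. (lam ^ n) ^ i) - of_nat m = (\<Sum>i<m. (lam ^ n) ^ i - 1)"
    by (simp add: sum_subtractf)
  moreover have "small ((lam ^ n) ^ i - 1) 1" for i
    using small_one_minus_lam_power[of "n * i"] small_minus_commute by (simp add: power_mult)
  ultimately show ?thesis by (simp add: small_sum)
qed

lemma absv_geometric: "\<not> p dvd m \<Longrightarrow> absv (\<Sum>i<m. (lam ^ n) ^ i) = 1"
proof -
  assume m: "\<not> p dvd m"
  have "absv ((\<Sum>i<m. (lam ^ n) ^ i) - of_nat m) < absv (of_nat m)"
  proof -
    have "absv ((\<Sum>i<m. (lam ^ n) ^ i) - of_nat m) \<le> q powr 1"
      using small_geometric by (simp only: small_def)
    also have "\<dots> < 1" using q_pos q_less_1 by (simp only: powr_one less_imp_le)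
    finally show ?thesis by (simp only: absv_of_nat[OF m])
  qed
  then have "absv (\<Sum>i<m. (lam ^ n) ^ i) = absv (of_nat m)"
    by (rule absv_eq_of_diff_less)
  then show ?thesis using absv_of_nat[OF m] by (rule trans)
qed

lemma absv_one_minus_lam_p_power: "absv (1 - lam ^ (p ^ j)) = q powr real (p ^ j)"
proof -
  have "lam ^ (p ^ j) = (1 + (lam - 1)) ^ (p ^ j)" by simp
  also have "\<dots> = 1 + (lam - 1) ^ (p ^ j)"
    using freshmans_dream'[of "p ^ j" j 1 "lam - 1"] prime_p CHAR_p by simp
  finally have "absv (lam ^ (p ^ j) - 1) = q ^ (p ^ j)"
    by (simp add: absv_power q_def)
  then show ?thesis
    using absv_minus[of "lam ^ (p ^ j) - 1"] q_pos by (simp add: powr_realpow flip: of_nat_power)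
qed

lemma absv_one_minus_lam_pw: "absv (1 - lam ^ (p ^ (l + \<tau>))) = q powr pw l"
  by (simp only: absv_one_minus_lam_p_power pw_def)

lemma one_minus_lam_pw_nonzero: "1 - lam ^ (p ^ (l + \<tau>)) \<noteq> 0"
  using absv_one_minus_lam_pw[of l] q_pos by (metis absv_0 less_irrefl powr_gt_zero)

lemma lam_power_eq:
  assumes "p ^ l dvd t" "\<not> p ^ Suc l dvd t"
  obtains m where "\<not> p dvd m"
    "1 - lam ^ (u * t) = (1 - lam ^ (p ^ (l + \<tau>))) * (\<Sum>i<m. (lam ^ (p ^ (l + \<tau>))) ^ i)"
proof -
  obtain w where w: "u = p ^ \<tau> * w" "\<not> p dvd w" by (rule u_decomp)
  obtain n where n: "t = p ^ l * n" using assms(1) by blast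
  have "\<not> p dvd n" using assms(2) n by auto
  then have "\<not> p dvd w * n" using w prime_p by (simp add: prime_dvd_mult_iff)
  moreover have "lam ^ (u * t) = (lam ^ (p ^ (l + \<tau>))) ^ (w * n)"
    by (simp add: w n power_add mult_ac flip: power_mult)
  ultimately show ?thesis using that one_diff_power_eq by metis
qed

lemma absv_one_minus_lam_power:
  assumes "p ^ l dvd t" "\<not> p ^ Suc l dvd t"
  shows "absv (1 - lam ^ (u * t)) = q powr pw l"
  using lam_power_eq[OF assms] absv_geometric absv_one_minus_lam_pw
  by (metis absv_mult mult.right_neutral)

lemma small_one_minus_lam_power_dvd:
  assumes "p ^ k dvd t"
  shows "small (1 - lam ^ (u * t)) (pw k)"
proof -
  obtain w where w: "u = p ^ \<tau> * w" by (rule u_decomp)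
  obtain n where n: "t = p ^ k * n" using assms by blast
  have "lam ^ (u * t) = (lam ^ (p ^ (k + \<tau>))) ^ (w * n)"
    by (simp add: w n power_add mult_ac flip: power_mult)
  then have "1 - lam ^ (u * t) = (1 - lam ^ (p ^ (k + \<tau>))) * (\<Sum>i<w * n. (lam ^ (p ^ (k + \<tau>))) ^ i)"
    using one_diff_power_eq by metis
  moreover have "small (\<Sum>i<w * n. (lam ^ (p ^ (k + \<tau>))) ^ i) 0"
    by (intro small_absv_1 absv_sum_le) (auto simp: absv_lam_power absv_power absv_lam)
  moreover have "small (1 - lam ^ (p ^ (k + \<tau>))) (pw k)"
    by (simp add: small_def absv_one_minus_lam_pw)
  ultimately show ?thesis by (auto intro: small_mult)
qed


section \<open>Bounds and near-periodicity of the chain sums\<close>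

text \<open>For \<open>r < s\<close> this is the numerator of \<open>Phi a (u * r) (u * s)\<close>,
  whose denominator is \<open>lam * (1 - lam ^ (u * s))\<close>.\<close>

definition pow_coeff :: "nat \<Rightarrow> nat \<Rightarrow> 'a" where
  "pow_coeff r s = fps_nth (Abs_fps a ^ (u * r + 1)) (u * s - u * r)"

definition val_level :: "nat \<Rightarrow> nat set" where
  "val_level l = {t. p ^ l dvd t \<and> \<not> p ^ Suc l dvd t}"

definition kap :: "nat \<Rightarrow> nat \<Rightarrow> 'a" where
  "kap l t = (1 - lam ^ (p ^ (l + \<tau>))) * lam ^ (u * t - 1) / (1 - lam ^ (u * t))"

text \<open>
  Up to the unit \<open>kap l s\<close>, \<open>psi l r s\<close> is \<open>phi l r s\<close> whenever \<open>p ^ l\<close> exactly divides \<open>s\<close>. The sum \<open>chi\<close>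
  is what one level up adds before dividing by the new small divisor.
\<close>

definition chi :: "nat \<Rightarrow> nat \<Rightarrow> nat \<Rightarrow> 'a" where
  "chi l r s = psi p a l r s +
     (\<Sum>t\<in>{r<..<s} \<inter> val_level l. phi p a (Suc l) r t * psi p a l t s)"

text \<open>The bound \<open>M_inf absv p a l \<ge> M\<close> multiplied out, so that a vanishing
  \<open>psi\<close> needs no special case.\<close>

definition psi_small :: "nat \<Rightarrow> real \<Rightarrow> bool" where
  "psi_small l M \<longleftrightarrow> (\<forall>r s. r < s \<longrightarrow> p ^ l dvd r \<longrightarrow> p ^ l dvd s \<longrightarrow>
     small (psi p a l r s) (M * (real s - real r)))"

lemma one_minus_lam_power_nonzero: "s > 0 \<Longrightarrow> 1 - lam ^ (u * s) \<noteq> 0"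
  using not_root_of_unity[of "u * s"] u_pos by (simp add: Suc_le_eq)

lemma phi_eq_psi: "s > 0 \<Longrightarrow> phi p a l r s = kap l s * psi p a l r s"
  using one_minus_lam_power_nonzero[of s] one_minus_lam_pw_nonzero[of l] lam_nonzero
  by (simp add: psi_def kap_def)

lemma phi_0: "r < s \<Longrightarrow> phi p a 0 r s = Phi a (u * r) (u * s)"
  by (subst phi_rec) simp_all

text \<open>At level 0 chains have no interior points, and \<open>psi\<close> replaces the divisor
  \<open>1 - lam ^ (u * s)\<close> by one that does not depend on \<open>s\<close>.\<close>

lemma psi_0:
  assumes "r < s"
  shows "psi p a 0 r s = pow_coeff r s / (lam ^ (u * s) * (1 - lam ^ (p ^ \<tau>)))"
proof -
  have "lam * lam ^ (u * s - 1) = lam ^ (u * s)"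
    using u_pos assms by (simp flip: power_Suc)
  moreover have "psi p a 0 r s = pow_coeff r s / (lam * (1 - lam ^ (u * s))) *
      ((1 - lam ^ (u * s)) / ((1 - lam ^ (p ^ \<tau>)) * lam ^ (u * s - 1)))"
    using assms by (simp add: psi_def phi_0 Phi_eq_fps_power_nth pow_coeff_def)
  ultimately show ?thesis
    using one_minus_lam_power_nonzero[of s] assms by (simp add: mult_ac)
qed

text \<open>The interior points that become admissible at level \<open>Suc l\<close> form
  \<open>val_level l\<close>; chains are cut at the last of these.\<close>

lemma phi_Suc:
  assumes "r < s"
  shows "phi p a (Suc l) r s = phi p a l r s +
    (\<Sum>t\<in>{r<..<s} \<inter> val_level l. phi p a (Suc l) r t * phi p a l t s)"
proof -
  have "{t. \<not> p ^ Suc l dvd t} - {t. \<not> p ^ l dvd t} = val_level l"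
    by (auto simp: val_level_def)
  moreover have "{t. \<not> p ^ l dvd t} \<subseteq> {t. \<not> p ^ Suc l dvd t}"
    by (auto dest: dvd_mult_right)
  ultimately show ?thesis
    using renewal_refine[of r "phi p a (Suc l) r" "\<lambda>r s. Phi a (u * r) (u * s)"
        "{t. \<not> p ^ Suc l dvd t}" "phi p a l" "{t. \<not> p ^ l dvd t}" s, OF phi_rec phi_rec _ assms]
    by simp
qed

lemma phi_Suc_eq_chi:
  assumes "r < t"
  shows "phi p a (Suc l) r t = kap l t * chi l r t"
  unfolding phi_Suc[OF assms] chi_def
  using assms phi_eq_psi[of t l] by (simp add: sum_distrib_left distrib_left mult_ac)

text \<open>The factor \<open>1 - lam ^ (u * s)\<close> cancels, and the quotient of the fixed
  divisors of levels \<open>l\<close> and \<open>Suc l\<close> is left; it costs the valuation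
  \<open>pw (Suc l) - pw l\<close>.\<close>

lemma psi_Suc_eq_chi:
  assumes "r < s"
  shows "psi p a (Suc l) r s =
    chi l r s * (1 - lam ^ (p ^ (l + \<tau>))) / (1 - lam ^ (p ^ (Suc l + \<tau>)))"
  using one_minus_lam_power_nonzero[of s] one_minus_lam_pw_nonzero lam_nonzero assms
  by (simp add: psi_def phi_Suc_eq_chi kap_def)

section \<open>Valuation bounds passed to the next level\<close>

lemma absv_kap: "t \<in> val_level l \<Longrightarrow> absv (kap l t) = 1"
  using absv_one_minus_lam_power[of l t] q_pos
  by (simp add: kap_def val_level_def absv_divide absv_mult absv_lam_power absv_one_minus_lam_pw)

text \<open>Bounds linear in the length add up along a chain. The bound on \<open>phi\<close> is a
  hypothesis so that the argument serves both inside the induction of \<open>phi_Suc_small\<close>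
  and after it.\<close>

lemma chi_small_aux:
  assumes "psi_small l M" "r < s" "p ^ l dvd r" "p ^ l dvd s"
    and "\<And>t. t \<in> {r<..<s} \<inter> val_level l \<Longrightarrow> small (phi p a (Suc l) r t) (M * (real t - real r))"
  shows "small (chi l r s) (M * (real s - real r))"
  unfolding chi_def
proof (intro small_add small_sum)
  show "small (psi p a l r s) (M * (real s - real r))"
    using assms by (simp add: psi_small_def)
  fix t assume t: "t \<in> {r<..<s} \<inter> val_level l"
  then have "small (psi p a l t s) (M * (real s - real t))"
    using assms by (auto simp: psi_small_def val_level_def)
  then show "small (phi p a (Suc l) r t * psi p a l t s) (M * (real s - real r))"
    by (rule small_mult[OF assms(5)[OF t]]) (simp add: algebra_simps)
qed

lemma phi_Suc_small:
  assumes "psi_small l M" "p ^ l dvd r" "r < t" "t \<in> val_level l"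
  shows "small (phi p a (Suc l) r t) (M * (real t - real r))"
  using assms(3,4)
proof (induction t rule: less_induct)
  case (less t)
  then have "small (chi l r t) (M * (real t - real r))"
    using assms by (intro chi_small_aux) (auto simp: val_level_def)
  then show ?case
    using less absv_kap by (simp add: phi_Suc_eq_chi small_unit_mult)
qed

lemma chi_small:
  assumes "psi_small l M" "r < s" "p ^ l dvd r" "p ^ l dvd s"
  shows "small (chi l r s) (M * (real s - real r))"
  using assms phi_Suc_small by (intro chi_small_aux) auto

lemma psi_Suc_small:
  assumes "psi_small l M" "r < s" "p ^ l dvd r" "p ^ l dvd s"
  shows "small (psi p a (Suc l) r s) (M * (real s - real r) + pw l - pw (Suc l))"
proof -
  have "small (chi l r s * (1 - lam ^ (p ^ (l + \<tau>)))) (M * (real s - real r) + pw l)"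
    by (rule small_mult[OF chi_small[OF assms]]) (auto simp: small_def absv_one_minus_lam_pw)
  then show ?thesis
    unfolding psi_Suc_eq_chi[OF assms(2)]
    by (rule small_divide[OF _ absv_one_minus_lam_pw order_refl])
qed

section \<open>Coefficients of powers of \<open>Abs_fps a\<close>\<close>

lemma pow_coeff_small:
  assumes "psi_small 0 M" "r < s"
  shows "small (pow_coeff r s) (M * (real s - real r) + pw 0)"
proof -
  have "pow_coeff r s = psi p a 0 r s * (lam ^ (u * s) * (1 - lam ^ (p ^ \<tau>)))"
    using one_minus_lam_pw_nonzero[of 0] lam_nonzero by (simp add: psi_0 assms)
  moreover have "small (lam ^ (u * s) * (1 - lam ^ (p ^ \<tau>))) (pw 0)"
    using absv_one_minus_lam_pw[of 0] by (simp add: small_def absv_mult absv_lam_power)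
  ultimately show ?thesis
    using assms by (auto simp: psi_small_def intro: small_mult)
qed

lemma coeff_small:
  assumes "psi_small 0 M" "n \<ge> 1"
  shows "small (a n) (M * (real n / real u) + pw 0)"
proof (cases "a n = 0")
  case False
  then obtain s where s: "n = u * s" using exp_gcd_dvd by blast
  then have "s > 0" using assms(2) by (cases s) auto
  then show ?thesis
    using pow_coeff_small[OF assms(1), of 0 s] u_pos s by (simp add: pow_coeff_def)
qed (simp add: small_0)

text \<open>The bound survives multiplication: constant terms have absolute value 1, and a product
  of two nonconstant terms has \<open>pw 0\<close> twice, of which one suffices.\<close>

lemma power_nth_small:
  assumes "psi_small 0 M" "n \<ge> 1"
  shows "small (fps_nth (Abs_fps a ^ m) n) (M * (real n / real u) + pw 0)"
  using assms(2)
proof (induction m arbitrary: n)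
  case 0
  then show ?case by (simp add: small_0)
next
  case (Suc m)
  have "small (a i * fps_nth (Abs_fps a ^ m) (n - i)) (M * (real n / real u) + pw 0)"
    if i: "i \<le> n" for i
  proof -
    consider "i = 0" | "i = n" "i \<noteq> 0" | "0 < i" "i < n" using i by linarith
    then show ?thesis
    proof cases
      case 1
      then show ?thesis using Suc by (simp add: small_unit_mult absv_lam)
    next
      case 2
      then show ?thesis using coeff_small[OF assms(1) Suc.prems] absv_lam_power[of m]
        by (simp add: small_unit_mult mult.commute[of "a n"] fps_power_zeroth)
    next
      case 3
      then have "small (a i) (M * (real i / real u) + pw 0)"
        using assms coeff_small by simp
      moreover have "small (fps_nth (Abs_fps a ^ m) (n - i)) (M * (real (n - i) / real u) + pw 0)"
        by (rule Suc.IH) (use 3 in simp)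
      moreover have "M * (real n / real u) + pw 0 \<le>
          (M * (real i / real u) + pw 0) + (M * (real (n - i) / real u) + pw 0)"
      proof -
        have "real n / real u = real i / real u + real (n - i) / real u"
          using i by (simp flip: add_divide_distrib)
        then show ?thesis using pw_pos[of 0] by (simp add: distrib_left)
      qed
      ultimately show ?thesis by (rule small_mult)
    qed
  qed
  then show ?case
    by (auto simp: fps_mult_nth intro!: small_sum)
qed

text \<open>\<open>u * t\<close> is a multiple of \<open>Q = p ^ (k + \<tau>)\<close>, so by
  Frobenius the nonzero coefficients are \<open>Q\<close>-th powers of coefficients of another power
  of the series. This turns the summand \<open>pw 0 \<ge> 1\<close> into at least
  \<open>Q = pw k\<close>.\<close>

lemma power_dvd_nth_small:
  assumes M: "psi_small 0 M" and k: "p ^ k dvd t" and n: "n \<ge> 1"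
  shows "small (fps_nth (Abs_fps a ^ (u * t)) n) (M * (real n / real u) + pw k)"
proof -
  obtain w where w: "u = p ^ \<tau> * w" by (rule u_decomp)
  obtain c where c: "t = p ^ k * c" using k by blast
  define Q where "Q = p ^ (k + \<tau>)"
  have "Abs_fps a ^ (u * t) = (Abs_fps a ^ (w * c)) ^ Q"
    by (simp add: w c Q_def power_add mult_ac flip: power_mult)
  then have eq: "fps_nth (Abs_fps a ^ (u * t)) n =
      (if Q dvd n then fps_nth (Abs_fps a ^ (w * c)) (n div Q) ^ Q else 0)"
    using fps_power_CHAR_power_nth[OF prime_p CHAR_p] by (simp add: Q_def)
  show ?thesis
  proof (cases "Q dvd n")
    case True
    then obtain i where i: "n = Q * i" by blast
    have "i \<ge> 1" "Q > 0" using i n by (auto simp: Suc_le_eq)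
    then have "small (fps_nth (Abs_fps a ^ (w * c)) i) (M * (real i / real u) + pw 0)"
      using power_nth_small[OF M] by blast
    moreover have "M * (real n / real u) + pw k \<le> real Q * (M * (real i / real u) + pw 0)"
    proof -
      have "real Q * 1 \<le> real Q * pw 0" using pw_pos by (intro mult_left_mono) auto
      then show ?thesis by (simp add: i algebra_simps pw_def flip: Q_def)
    qed
    ultimately have "small (fps_nth (Abs_fps a ^ (w * c)) i ^ Q) (M * (real n / real u) + pw k)"
      by (rule small_power)
    then show ?thesis using eq True i \<open>Q > 0\<close> by simp
  next
    case False
    then show ?thesis using eq by (simp add: small_0)
  qed
qed

text \<open>The shift multiplies the series by \<open>Abs_fps a ^ (u * r\<^sub>0)\<close>: its
  constant term gives the main term, and \<open>power_dvd_nth_small\<close> bounds the rest.\<close>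

lemma pow_coeff_shift:
  assumes M: "psi_small 0 M" and k: "p ^ k dvd r\<^sub>0" and rs: "r < s"
  shows "small (pow_coeff (r\<^sub>0 + r) (r\<^sub>0 + s) - lam ^ (u * r\<^sub>0) * pow_coeff r s)
    (M * (real s - real r) + pw k)"
proof -
  define d where "d = u * s - u * r"
  have ds: "real d / real u = real s - real r"
    using rs u_pos by (simp add: d_def of_nat_diff field_simps)
  define F G where "F = Abs_fps a ^ (u * r + 1)" and "G = Abs_fps a ^ (u * r\<^sub>0)"
  have "pow_coeff (r\<^sub>0 + r) (r\<^sub>0 + s) = fps_nth (F * G) d"
    by (simp add: pow_coeff_def F_def G_def d_def algebra_simps power_add)
  also have "\<dots> = (\<Sum>j=0..d. fps_nth F j * fps_nth G (d - j))"
    by (rule fps_mult_nth)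
  also have "\<dots> = (\<Sum>j<d. fps_nth F j * fps_nth G (d - j)) + fps_nth F d * fps_nth G 0"
    by (simp add: atLeast0AtMost lessThan_Suc_atMost[symmetric])
  also have "fps_nth F d * fps_nth G 0 = lam ^ (u * r\<^sub>0) * pow_coeff r s"
    by (simp add: G_def F_def d_def pow_coeff_def fps_power_zeroth)
  finally have "pow_coeff (r\<^sub>0 + r) (r\<^sub>0 + s) - lam ^ (u * r\<^sub>0) * pow_coeff r s =
      (\<Sum>j<d. fps_nth F j * fps_nth G (d - j))" by simp
  moreover have "small (fps_nth F j * fps_nth G (d - j)) (M * (real s - real r) + pw k)"
    if j: "j < d" for j
  proof -
    have "small (fps_nth F j) (M * (real j / real u))"
    proof (cases "j = 0")
      case True
      then show ?thesis
        using absv_lam_power[of "u * r + 1"] small_absv_1[of "lam ^ (u * r + 1)"]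
        by (simp add: F_def fps_power_zeroth)
    next
      case False
      then have "small (fps_nth F j) (M * (real j / real u) + pw 0)"
        unfolding F_def by (intro power_nth_small M) simp
      then show ?thesis using pw_pos[of 0] by (elim small_mono) simp
    qed
    moreover have "small (fps_nth G (d - j)) (M * (real (d - j) / real u) + pw k)"
      unfolding G_def using j by (intro power_dvd_nth_small M k) simp
    moreover have "M * (real s - real r) + pw k \<le>
        M * (real j / real u) + (M * (real (d - j) / real u) + pw k)"
    proof -
      have "real d / real u = real j / real u + real (d - j) / real u"
        using j by (simp flip: add_divide_distrib)
      then show ?thesis by (simp add: distrib_left flip: ds)
    qed
    ultimately show ?thesis by (rule small_mult)
  qed
  ultimately show ?thesis by (auto intro!: small_sum)
qed

text \<open>The main factor \<open>lam ^ (u * r\<^sub>0)\<close> cancels against the denominator in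
  \<open>psi_0\<close>; here the power of \<open>lam\<close> in the definition of \<open>psi\<close>
  pays off.\<close>

lemma psi_0_shift:
  assumes M: "psi_small 0 M" and k: "p ^ k dvd r\<^sub>0" and rs: "r < s"
  shows "small (psi p a 0 (r\<^sub>0 + r) (r\<^sub>0 + s) - psi p a 0 r s) (M * (real s - real r) + pw k - pw 0)"
proof -
  define y where "y = lam ^ (u * r\<^sub>0)"
  define c where "c = lam ^ (u * s) * (1 - lam ^ (p ^ \<tau>))"
  have y: "y \<noteq> 0" "absv y = 1" using lam_nonzero by (auto simp: y_def absv_lam_power)
  have "psi p a 0 (r\<^sub>0 + r) (r\<^sub>0 + s) = pow_coeff (r\<^sub>0 + r) (r\<^sub>0 + s) / (y * c)"
    using rs by (simp add: psi_0 y_def c_def power_add distrib_left)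
  moreover have "psi p a 0 r s = y * pow_coeff r s / (y * c)"
    using rs y by (simp add: psi_0 c_def)
  ultimately have "psi p a 0 (r\<^sub>0 + r) (r\<^sub>0 + s) - psi p a 0 r s
      = (pow_coeff (r\<^sub>0 + r) (r\<^sub>0 + s) - y * pow_coeff r s) / (y * c)"
    by (simp add: diff_divide_distrib)
  moreover have "absv (y * c) = q powr pw 0"
    using absv_one_minus_lam_pw[of 0] y by (simp add: c_def absv_mult absv_lam_power)
  ultimately show ?thesis
    using small_divide[OF pow_coeff_shift[OF assms]] by (simp add: y_def)
qed

section \<open>Near-periodicity at higher levels\<close>

lemma val_level_shift:
  assumes k: "p ^ k dvd r\<^sub>0" and l: "l < k"
  shows "r\<^sub>0 + t \<in> val_level l \<longleftrightarrow> t \<in> val_level l"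
proof -
  have "p ^ l dvd r\<^sub>0" "p ^ Suc l dvd r\<^sub>0"
    using k l by (meson Suc_leI dvd_trans le_imp_power_dvd less_imp_le)+
  then show ?thesis
    by (auto simp: val_level_def dvd_add_right_iff simp del: power_Suc)
qed

text \<open>Over a common denominator the numerator is \<open>c * (y - 1)\<close> with
  \<open>y = lam ^ (u * r\<^sub>0)\<close>; of its valuation, at least \<open>pw l + pw k\<close>,
  the two denominators remove \<open>2 * pw l\<close>.\<close>

lemma kap_shift:
  assumes k: "p ^ k dvd r\<^sub>0" and l: "l < k" and t: "t \<in> val_level l"
  shows "small (kap l (r\<^sub>0 + t) - kap l t) (pw k - pw l)"
proof -
  have t': "r\<^sub>0 + t \<in> val_level l"
    using t val_level_shift[OF k l] by simp
  have tpos: "t > 0" using t by (auto simp: val_level_def intro: gr0I)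
  define x y c where "x = lam ^ (u * t)" and "y = lam ^ (u * r\<^sub>0)"
    and "c = (1 - lam ^ (p ^ (l + \<tau>))) * lam ^ (u * t - 1)"
  have "u * (r\<^sub>0 + t) - 1 = u * r\<^sub>0 + (u * t - 1)"
    using tpos u_pos by (simp add: algebra_simps)
  then have "kap l (r\<^sub>0 + t) = c * y / (1 - x * y)"
    by (simp add: kap_def c_def x_def y_def power_add distrib_left mult_ac)
  moreover have "kap l t = c / (1 - x)" by (simp add: kap_def c_def x_def)
  moreover have xy: "absv (1 - x * y) = q powr pw l" "absv (1 - x) = q powr pw l"
    using absv_one_minus_lam_power[of l t] absv_one_minus_lam_power[of l "r\<^sub>0 + t"] t t'
    by (simp_all add: val_level_def x_def y_def power_add distrib_left mult.commute)
  moreover have "1 - x * y \<noteq> 0" "1 - x \<noteq> 0"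
    using xy q_pos by (metis absv_0 less_irrefl powr_gt_zero)+
  ultimately have "kap l (r\<^sub>0 + t) - kap l t =
      (c * y * (1 - x) - c * (1 - x * y)) / ((1 - x * y) * (1 - x))"
    by (metis diff_frac_eq)
  also have "c * y * (1 - x) - c * (1 - x * y) = c * (y - 1)"
    by (simp add: algebra_simps)
  finally have "kap l (r\<^sub>0 + t) - kap l t = c * (y - 1) / ((1 - x * y) * (1 - x))" .
  moreover have "small (c * (y - 1)) (pw l + pw k)"
  proof (rule small_mult[of _ "pw l" _ "pw k"])
    show "small c (pw l)"
      by (simp add: small_def c_def absv_mult absv_lam_power absv_one_minus_lam_pw)
    show "small (y - 1) (pw k)"
      using small_one_minus_lam_power_dvd[OF k] small_minus_commute by (simp add: y_def)
  qed simp
  moreover have "absv ((1 - x * y) * (1 - x)) = q powr (pw l + pw l)"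
    by (simp only: absv_mult xy powr_add)
  ultimately show ?thesis
    using small_divide[of "c * (y - 1)" "pw l + pw k" _ "pw l + pw l"] by simp
qed

lemma small_mult_diff:
  assumes "small (x' - x) (s + e)" "small (y' - y) (t + e)" "small x s" "small y' t"
  shows "small (x' * y' - x * y) (s + t + e)"
proof -
  have "x' * y' - x * y = (x' - x) * y' + x * (y' - y)"
    by (simp add: algebra_simps)
  moreover have "small ((x' - x) * y') (s + t + e)" "small (x * (y' - y)) (s + t + e)"
    by (rule small_mult[OF assms(1,4)], simp, rule small_mult[OF assms(3,2)], simp)
  ultimately show ?thesis by (simp add: small_add)
qed

text \<open>
  Since \<open>Abs_fps a ^ (u * r\<^sub>0)\<close> is a \<open>p ^ (k + \<tau>)\<close>-th power, its nonconstant coefficients are so small that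
  shifting both indices by \<open>r\<^sub>0\<close> changes \<open>psi l\<close> only by terms that stay small after division by
  the small divisors up to level \<open>k\<close>.
\<close>

definition psi_shift :: "nat \<Rightarrow> nat \<Rightarrow> real \<Rightarrow> bool" where
  "psi_shift k l M \<longleftrightarrow> (\<forall>r\<^sub>0 r s. p ^ k dvd r\<^sub>0 \<longrightarrow> r < s \<longrightarrow> p ^ l dvd r \<longrightarrow> p ^ l dvd s \<longrightarrow>
     small (psi p a l (r\<^sub>0 + r) (r\<^sub>0 + s) - psi p a l r s) (M * (real s - real r) + (pw k - pw l)))"

text \<open>Shifting by \<open>r\<^sub>0\<close> maps the interior points in
  \<open>val_level l\<close> bijectively, so the sums are compared term by term; as in
  \<open>chi_small_aux\<close>, the claim for \<open>phi\<close> is left as a hypothesis.\<close>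

lemma chi_shift_aux:
  assumes S: "psi_shift k l M" and M: "psi_small l M" and l: "l < k"
    and r0: "p ^ k dvd r\<^sub>0" and rs: "r < s" "p ^ l dvd r" "p ^ l dvd s"
    and phi: "\<And>t. t \<in> {r<..<s} \<inter> val_level l \<Longrightarrow>
      small (phi p a (Suc l) (r\<^sub>0 + r) (r\<^sub>0 + t) - phi p a (Suc l) r t)
        (M * (real t - real r) + (pw k - pw l))"
  shows "small (chi l (r\<^sub>0 + r) (r\<^sub>0 + s) - chi l r s) (M * (real s - real r) + (pw k - pw l))"
proof -
  have "{r\<^sub>0 + r<..<r\<^sub>0 + s} \<inter> val_level l = (+) r\<^sub>0 ` ({r<..<s} \<inter> val_level l)"
  proof (intro Set.set_eqI iffI)
    fix t assume t: "t \<in> {r\<^sub>0 + r<..<r\<^sub>0 + s} \<inter> val_level l"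
    then have "t = r\<^sub>0 + (t - r\<^sub>0)" by auto
    moreover from this have "t - r\<^sub>0 \<in> {r<..<s} \<inter> val_level l"
      using t val_level_shift[OF r0 l, of "t - r\<^sub>0"] by auto
    ultimately show "t \<in> (+) r\<^sub>0 ` ({r<..<s} \<inter> val_level l)" by blast
  qed (use val_level_shift[OF r0 l] in auto)
  then have "(\<Sum>t\<in>{r\<^sub>0 + r<..<r\<^sub>0 + s} \<inter> val_level l. phi p a (Suc l) (r\<^sub>0 + r) t * psi p a l t (r\<^sub>0 + s))
      = (\<Sum>t\<in>{r<..<s} \<inter> val_level l. phi p a (Suc l) (r\<^sub>0 + r) (r\<^sub>0 + t) * psi p a l (r\<^sub>0 + t) (r\<^sub>0 + s))"
    by (simp add: sum.reindex)
  then have "chi l (r\<^sub>0 + r) (r\<^sub>0 + s) - chi l r s =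
      (psi p a l (r\<^sub>0 + r) (r\<^sub>0 + s) - psi p a l r s) +
      (\<Sum>t\<in>{r<..<s} \<inter> val_level l.
        phi p a (Suc l) (r\<^sub>0 + r) (r\<^sub>0 + t) * psi p a l (r\<^sub>0 + t) (r\<^sub>0 + s)
          - phi p a (Suc l) r t * psi p a l t s)"
    by (simp add: chi_def sum_subtractf)
  moreover have "small (psi p a l (r\<^sub>0 + r) (r\<^sub>0 + s) - psi p a l r s)
      (M * (real s - real r) + (pw k - pw l))"
    using S r0 rs by (simp add: psi_shift_def)
  moreover have "small (phi p a (Suc l) (r\<^sub>0 + r) (r\<^sub>0 + t) * psi p a l (r\<^sub>0 + t) (r\<^sub>0 + s)
          - phi p a (Suc l) r t * psi p a l t s) (M * (real s - real r) + (pw k - pw l))"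
    if t: "t \<in> {r<..<s} \<inter> val_level l" for t
  proof -
    have pl: "p ^ l dvd r\<^sub>0" using r0 l by (meson dvd_trans le_imp_power_dvd less_imp_le)
    have "small (psi p a l (r\<^sub>0 + t) (r\<^sub>0 + s) - psi p a l t s)
        (M * (real s - real t) + (pw k - pw l))"
      using S r0 rs t by (auto simp: psi_shift_def val_level_def)
    moreover have "small (phi p a (Suc l) r t) (M * (real t - real r))"
      using phi_Suc_small[OF M] rs t by simp
    moreover have "small (psi p a l (r\<^sub>0 + t) (r\<^sub>0 + s)) (M * (real (r\<^sub>0 + s) - real (r\<^sub>0 + t)))"
    proof -
      have "p ^ l dvd r\<^sub>0 + t" "p ^ l dvd r\<^sub>0 + s" "r\<^sub>0 + t < r\<^sub>0 + s"
        using pl rs t by (auto simp: val_level_def)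
      then show ?thesis using M unfolding psi_small_def by blast
    qed
    then have "small (psi p a l (r\<^sub>0 + t) (r\<^sub>0 + s)) (M * (real s - real t))"
      by simp
    ultimately have "small (phi p a (Suc l) (r\<^sub>0 + r) (r\<^sub>0 + t) * psi p a l (r\<^sub>0 + t) (r\<^sub>0 + s)
          - phi p a (Suc l) r t * psi p a l t s)
        (M * (real t - real r) + M * (real s - real t) + (pw k - pw l))"
      using small_mult_diff[OF phi[OF t]] by blast
    then show ?thesis by (rule small_mono) (simp add: algebra_simps)
  qed
  ultimately show ?thesis by (simp only: small_add small_sum)
qed

lemma phi_Suc_shift:
  assumes S: "psi_shift k l M" and M: "psi_small l M" and l: "l < k"
    and r0: "p ^ k dvd r\<^sub>0" and r: "p ^ l dvd r" and "r < t" "t \<in> val_level l"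
  shows "small (phi p a (Suc l) (r\<^sub>0 + r) (r\<^sub>0 + t) - phi p a (Suc l) r t)
    (M * (real t - real r) + (pw k - pw l))"
  using assms(6-)
proof (induction t rule: less_induct)
  case (less t)
  have pl: "p ^ l dvd t" "p ^ l dvd r\<^sub>0"
    using less.prems power_le_dvd[OF r0, of l] l by (auto simp: val_level_def)
  have "small (chi l (r\<^sub>0 + r) (r\<^sub>0 + t) - chi l r t) (M * (real t - real r) + (pw k - pw l))"
    using less pl by (intro chi_shift_aux[OF S M l r0] r) auto
  moreover have "small (chi l (r\<^sub>0 + r) (r\<^sub>0 + t)) (M * (real (r\<^sub>0 + t) - real (r\<^sub>0 + r)))"
    using less.prems r pl by (intro chi_small M) auto
  then have "small (chi l (r\<^sub>0 + r) (r\<^sub>0 + t)) (M * (real t - real r))" by simp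
  moreover have "small (kap l t) 0"
    using absv_kap less.prems by (intro small_absv_1) simp
  ultimately have "small (kap l (r\<^sub>0 + t) * chi l (r\<^sub>0 + r) (r\<^sub>0 + t) - kap l t * chi l r t)
      (0 + M * (real t - real r) + (pw k - pw l))"
    using kap_shift[OF r0 l less.prems(2)] by (intro small_mult_diff) simp_all
  then show ?case using less.prems by (simp add: phi_Suc_eq_chi)
qed

text \<open>Going up one level costs \<open>pw (Suc l) - pw l\<close>, by which the gain
  \<open>pw k - pw l\<close> shrinks. At \<open>l = k\<close> it is used up, but the bound
  \<open>M\<close> still comes from the levels below \<open>k\<close>.\<close>

lemma psi_shiftI:
  assumes M: "\<And>l. l < k \<Longrightarrow> psi_small l M" and l: "l \<le> k" and k: "k \<ge> 1"
  shows "psi_shift k l M"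
  using l
proof (induction l)
  case 0
  have "psi_small 0 M" using M k by simp
  then show ?case using psi_0_shift by (simp add: psi_shift_def algebra_simps)
next
  case (Suc l)
  then have S: "psi_shift k l M" and lk: "l < k" by auto
  show ?case unfolding psi_shift_def
  proof (intro allI impI)
    fix r\<^sub>0 r s assume r0: "p ^ k dvd r\<^sub>0" and rs: "r < s" and "p ^ Suc l dvd r" "p ^ Suc l dvd s"
    then have d: "p ^ l dvd r" "p ^ l dvd s" by (auto dest: dvd_mult_right)
    have "small (chi l (r\<^sub>0 + r) (r\<^sub>0 + s) - chi l r s) (M * (real s - real r) + (pw k - pw l))"
      using chi_shift_aux[OF S M[OF lk] lk r0 rs d] phi_Suc_shift[OF S M[OF lk] lk r0 d(1)] by auto
    moreover have "small (1 - lam ^ (p ^ (l + \<tau>))) (pw l)"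
      by (simp add: small_def absv_one_minus_lam_pw)
    ultimately have "small ((chi l (r\<^sub>0 + r) (r\<^sub>0 + s) - chi l r s) * (1 - lam ^ (p ^ (l + \<tau>))))
        (M * (real s - real r) + pw k)"
      by (rule small_mult) simp
    then have "small ((chi l (r\<^sub>0 + r) (r\<^sub>0 + s) - chi l r s) * (1 - lam ^ (p ^ (l + \<tau>)))
        / (1 - lam ^ (p ^ (Suc l + \<tau>)))) (M * (real s - real r) + (pw k - pw (Suc l)))"
      by (rule small_divide[OF _ absv_one_minus_lam_pw]) simp
    then show "small (psi p a (Suc l) (r\<^sub>0 + r) (r\<^sub>0 + s) - psi p a (Suc l) r s)
        (M * (real s - real r) + (pw k - pw (Suc l)))"
      using rs by (simp add: psi_Suc_eq_chi left_diff_distrib diff_divide_distrib)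
  qed
qed


section \<open>Dominance propagates\<close>

definition ep :: real where "ep = real p powi (int \<tau> - 1)"

text \<open>
  The invariant of the induction on \<open>k\<close>: \<open>M\<close> is any lower bound for the slopes below level \<open>k\<close>, not
  necessarily their minimum.
\<close>

definition dominant_at :: "nat \<Rightarrow> real \<Rightarrow> bool" where
  "dominant_at k M \<longleftrightarrow> (\<forall>l<k. psi_small l M) \<and>
     (\<exists>d\<in>{1..p - 1}. q powr ((M - ep) * real (d * p ^ k)) \<le> absv (psi p a k 0 (d * p ^ k)))"

lemma ep_pos: "ep > 0"
  using p_gt_0 by (simp add: ep_def)

text \<open>A slope gap of \<open>ep\<close> over a step \<open>p ^ Suc k\<close> is worth a small
  divisor of level \<open>k\<close>; this explains the constant in the definition of
  dominance.\<close>

lemma ep_mult: "ep * real (p ^ Suc k) = pw k"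
proof -
  have "ep * real p = real p powi int \<tau>"
    using p_gt_0 by (simp add: ep_def power_int_diff)
  then show ?thesis by (simp add: pw_def power_add mult.commute mult.left_commute)
qed

lemma psi_shiftD:
  "psi_shift k l M \<Longrightarrow> p ^ k dvd r\<^sub>0 \<Longrightarrow> r < s \<Longrightarrow> p ^ l dvd r \<Longrightarrow> p ^ l dvd s \<Longrightarrow>
    small (psi p a l (r\<^sub>0 + r) (r\<^sub>0 + s) - psi p a l r s) (M * (real s - real r) + (pw k - pw l))"
  by (simp add: psi_shift_def)

lemma psi_small_mono:
  assumes "psi_small l M" "D \<le> M"
  shows "psi_small l D"
  unfolding psi_small_def
proof (intro allI impI)
  fix r s :: nat assume rs: "r < s" "p ^ l dvd r" "p ^ l dvd s"
  then have "D * (real s - real r) \<le> M * (real s - real r)"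
    using assms(2) by (intro mult_right_mono) auto
  then show "small (psi p a l r s) (D * (real s - real r))"
    using assms(1) rs small_mono unfolding psi_small_def by blast
qed

lemma val_level_times: "n * p ^ k \<in> val_level k \<longleftrightarrow> \<not> p dvd n"
  using p_gt_0 by (simp add: val_level_def)

lemma ex_minimal_slope:
  assumes "k \<ge> 1" "dominant_at k M"
  obtains D d where "D \<le> M - ep" "d \<in> {1..p - 1}" "absv (psi p a k 0 (d * p ^ k)) = q powr (D * real (d * p ^ k))"
    "\<And>j. j \<in> {1..p - 1} \<Longrightarrow> small (psi p a k 0 (j * p ^ k)) (D * real (j * p ^ k))"
proof -
  define x where "x j = psi p a k 0 (j * p ^ k)" for j
  \<comment> \<open>Zero values have infinite slope; leaving them out keeps the minimum real. The
    witness \<open>e\<close> of dominance keeps \<open>S\<close> nonempty.\<close>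
  define S where "S = {j \<in> {1..p - 1}. x j \<noteq> 0}"
  define v where "v j = log q (absv (x j)) / real (j * p ^ k)" for j
  obtain e where e: "e \<in> {1..p - 1}" "q powr ((M - ep) * real (e * p ^ k)) \<le> absv (x e)"
    using assms(2) by (auto simp: dominant_at_def x_def)
  have "0 < q powr ((M - ep) * real (e * p ^ k))" using q_pos by simp
  then have "absv (x e) > 0" using e(2) by linarith
  then have eS: "e \<in> S" using e(1) by (auto simp: S_def)
  have pos: "real (j * p ^ k) > 0" if "j \<in> {1..p - 1}" for j
    using that p_gt_0 by simp
  have eq: "absv (x j) = q powr (v j * real (j * p ^ k))" if "j \<in> S" for j
  proof -
    have "absv (x j) > 0" using that absv_nonneg[of "x j"] by (auto simp: S_def absv_eq_0_iff less_le)
    then show ?thesis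
      using that pos[of j] q_pos q_less_1 by (auto simp: v_def S_def)
  qed
  define D where "D = Min (v ` S)"
  have fin: "finite S" by (simp add: S_def)
  have "D \<in> v ` S" using fin eS unfolding D_def by (intro Min_in) auto
  then obtain d where d: "d \<in> S" "D = v d" by blast
  have "D \<le> v e" using fin eS by (simp add: D_def)
  also have "v e \<le> M - ep"
    using e(2) pos[OF e(1)] unfolding eq[OF eS] q_powr_le_iff by (rule mult_right_le_imp_le)
  finally have "D \<le> M - ep" .
  moreover have "small (x j) (D * real (j * p ^ k))" if j: "j \<in> {1..p - 1}" for j
  proof (cases "x j = 0")
    case False
    then have jS: "j \<in> S" using j by (simp add: S_def)
    then have "D \<le> v j" using fin by (simp add: D_def)
    then show ?thesis using eq[OF jS] q_powr_le_iff
      by (auto simp: small_def intro: mult_right_mono)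
  qed (simp add: small_0)
  ultimately show ?thesis
    using that[of D d] d eq[OF d(1)] by (auto simp: x_def S_def)
qed

text \<open>With \<open>l = k - 1\<close>, the gap \<open>D \<le> M - ep\<close> gains
  \<open>j * pw l\<close> over a step \<open>j * p ^ k\<close>. For \<open>j < p\<close>
  near-periodicity loses nothing of it; for \<open>j \<ge> p\<close> it outweighs the loss
  \<open>(p - 1) * pw l\<close> in passing from level \<open>l\<close> to \<open>k\<close>. Either
  way at least 1 remains.\<close>

lemma psi_near_initial:
  assumes k: "k \<ge> 1" and M: "\<And>l. l < k \<Longrightarrow> psi_small l M" and D: "D \<le> M - ep"
    and rs: "p ^ k dvd r" "j \<ge> 1"
  shows "small (psi p a k r (r + j * p ^ k) - (if j < p then psi p a k 0 (j * p ^ k) else 0))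
    (D * real (j * p ^ k) + 1)"
proof -
  obtain l where l: "k = Suc l" using k by (cases k) auto
  have "D * real (j * p ^ k) \<le> (M - ep) * real (j * p ^ k)"
    using D by (intro mult_right_mono) auto
  then have DM: "D * real (j * p ^ k) + j * pw l \<le> M * real (j * p ^ k)"
    using ep_mult[of l] by (simp add: l algebra_simps)
  show ?thesis
  proof (cases "j < p")
    case True
    have "psi_shift k k M" using psi_shiftI[of k M k] M k by simp
    then have "small (psi p a k (r + 0) (r + j * p ^ k) - psi p a k 0 (j * p ^ k))
        (M * (real (j * p ^ k) - real 0) + (pw k - pw k))"
      by (rule psi_shiftD) (use rs p_gt_0 in auto)
    moreover have "1 \<le> real j * pw l"
      using rs(2) pw_pos[of l] mult_mono[of 1 "real j" 1 "pw l"] by simp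
    ultimately show ?thesis
      using True DM by (auto elim!: small_mono)
  next
    case False
    have "p ^ l dvd p ^ k" by (simp add: l)
    then have "p ^ l dvd r" "p ^ l dvd r + j * p ^ k"
      using rs(1) by (auto intro: dvd_trans)
    moreover have "r < r + j * p ^ k" "psi_small l M" using rs p_gt_0 M l by auto
    ultimately have
      "small (psi p a k r (r + j * p ^ k)) (M * (real (r + j * p ^ k) - real r) + pw l - pw k)"
      unfolding l by (intro psi_Suc_small)
    moreover have "pw k \<le> real j * pw l"
      using False pw_pos[of l] by (simp add: l pw_Suc mult_right_mono)
    ultimately show ?thesis
      using False DM pw_pos[of l] by (auto elim!: small_mono)
  qed
qed

text \<open>\<open>kap k (n * p ^ k)\<close> is a power of \<open>lam\<close> over a geometric sum
  of \<open>w * n\<close> terms, thus \<open>1 / (w * n)\<close> to leading order. This inverse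
  index is what turns the recursion into a differential equation.\<close>

lemma kap_near:
  assumes w: "u = p ^ \<tau> * w" "\<not> p dvd w" and n: "\<not> p dvd n"
  shows "small (of_nat (w * n) * kap k (n * p ^ k) - 1) 1"
proof -
  define \<Lambda> S where "\<Lambda> = lam ^ (p ^ (k + \<tau>))" and "S = (\<Sum>i<w * n. \<Lambda> ^ i)"
  have m: "\<not> p dvd w * n" using w n prime_p by (simp add: prime_dvd_mult_iff)
  have S: "absv S = 1" unfolding S_def \<Lambda>_def by (rule absv_geometric[OF m])
  then have S0: "S \<noteq> 0" by auto
  have "lam ^ (u * (n * p ^ k)) = \<Lambda> ^ (w * n)"
    by (simp add: \<Lambda>_def w power_add mult_ac flip: power_mult)
  then have "1 - lam ^ (u * (n * p ^ k)) = (1 - \<Lambda>) * S"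
    unfolding S_def by (simp only: one_diff_power_eq)
  moreover have "1 - \<Lambda> \<noteq> 0" using one_minus_lam_pw_nonzero by (simp add: \<Lambda>_def)
  ultimately have "kap k (n * p ^ k) = lam ^ (u * (n * p ^ k) - 1) / S"
    by (simp add: kap_def flip: \<Lambda>_def)
  then have "of_nat (w * n) * kap k (n * p ^ k) - 1 =
      (of_nat (w * n) * lam ^ (u * (n * p ^ k) - 1) - S) / S"
    using S0 by (simp add: diff_divide_distrib)
  also have "of_nat (w * n) * lam ^ (u * (n * p ^ k) - 1) - S =
      of_nat (w * n) * (lam ^ (u * (n * p ^ k) - 1) - 1) - (S - of_nat (w * n))"
    by (simp add: algebra_simps)
  finally have eq: "of_nat (w * n) * kap k (n * p ^ k) - 1 =
      (of_nat (w * n) * (lam ^ (u * (n * p ^ k) - 1) - 1) - (S - of_nat (w * n))) / S" .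
  have "small (of_nat (w * n) * (lam ^ (u * (n * p ^ k) - 1) - 1)) 1"
    using small_one_minus_lam_power[of "u * (n * p ^ k) - 1"] small_minus_commute
      small_unit_mult[OF absv_of_nat[OF m]] by blast
  moreover have "small (S - of_nat (w * n)) 1"
    unfolding S_def \<Lambda>_def by (rule small_geometric)
  ultimately have "small (of_nat (w * n) * (lam ^ (u * (n * p ^ k) - 1) - 1) - (S - of_nat (w * n))) 1"
    by (rule small_diff)
  then show ?thesis
    unfolding eq by (rule small_divide[where t = 0]) (use S q_pos in simp_all)
qed

lemma chi_0_eq_sum:
  "chi k 0 (n * p ^ k) = psi p a k 0 (n * p ^ k) +
    (\<Sum>i\<in>{i\<in>{0<..<n}. \<not> p dvd i}. phi p a (Suc k) 0 (i * p ^ k) * psi p a k (i * p ^ k) (n * p ^ k))"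
proof -
  have "{0<..<n * p ^ k} \<inter> val_level k = (\<lambda>i. i * p ^ k) ` {i\<in>{0<..<n}. \<not> p dvd i}"
  proof (intro Set.set_eqI iffI)
    fix t assume t: "t \<in> {0<..<n * p ^ k} \<inter> val_level k"
    then obtain i where "t = i * p ^ k" by (auto simp: val_level_def mult.commute elim!: dvdE)
    then show "t \<in> (\<lambda>i. i * p ^ k) ` {i\<in>{0<..<n}. \<not> p dvd i}"
      using t val_level_times by auto
  qed (use p_gt_0 val_level_times in auto)
  moreover have "inj_on (\<lambda>i. i * p ^ k) {i\<in>{0<..<n}. \<not> p dvd i}"
    using p_gt_0 by (auto simp: inj_on_def)
  ultimately show ?thesis by (simp add: chi_def sum.reindex)
qed

text \<open>By \<open>psi_near_initial\<close> the finitely many values from 0 with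
  \<open>j < p\<close> control the whole level; the error terms lie above slope
  \<open>D\<close>.\<close>

lemma psi_small_level:
  assumes k: "k \<ge> 1" and M: "\<And>l. l < k \<Longrightarrow> psi_small l M" and D: "D \<le> M - ep"
    and small_j: "\<And>j. j \<in> {1..p - 1} \<Longrightarrow> small (psi p a k 0 (j * p ^ k)) (D * real (j * p ^ k))"
  shows "psi_small k D"
  unfolding psi_small_def
proof (intro allI impI)
  fix r s assume rs: "r < s" "p ^ k dvd r" "p ^ k dvd s"
  then have "p ^ k dvd s - r" by simp
  then obtain j where j: "s - r = j * p ^ k" by (metis dvd_div_mult_self)
  then have s: "s = r + j * p ^ k" "j \<ge> 1" using rs by (auto simp: Suc_le_eq intro!: gr0I)
  define c where "c = (if j < p then psi p a k 0 (j * p ^ k) else 0)"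
  have "small (psi p a k r s - c) (D * real (j * p ^ k))"
    using psi_near_initial[OF k M D rs(2) s(2)] unfolding c_def s(1) by (rule small_mono) auto
  moreover have "small c (D * real (j * p ^ k))"
    using small_j[of j] s(2) by (auto simp: c_def small_0)
  ultimately have "small (psi p a k r s - c + c) (D * real (j * p ^ k))"
    by (rule small_add)
  then show "small (psi p a k r s) (D * (real s - real r))"
    by (simp add: s)
qed

text \<open>If all these \<open>psi\<close> were smaller, then \<open>R = B * E\<close> would be
  small up to degree \<open>p * d\<close>, and so would \<open>E\<close>, the deviation of
  \<open>w L\<close> from \<open>C\<close>. The Frobenius relation for \<open>L\<close> between the
  degrees \<open>d\<close> and \<open>p * d\<close> excludes this.\<close>

lemma dominant_step_aux:
  assumes k: "k \<ge> 1" and M: "\<And>l. l < k \<Longrightarrow> psi_small l M" and D: "D \<le> M - ep"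
    and d: "d \<in> {1..p - 1}" "absv (psi p a k 0 (d * p ^ k)) = q powr (D * real (d * p ^ k))"
    and small_j: "\<And>j. j \<in> {1..p - 1} \<Longrightarrow> small (psi p a k 0 (j * p ^ k)) (D * real (j * p ^ k))"
  shows "\<exists>e\<in>{1..p - 1}. q powr ((D - ep) * real (e * p ^ Suc k)) \<le> absv (psi p a (Suc k) 0 (e * p ^ Suc k))"
proof (rule ccontr)
  assume "\<not> ?thesis"
  then have psi_less: "absv (psi p a (Suc k) 0 (e * p ^ Suc k)) < q powr ((D - ep) * real (e * p ^ Suc k))"
    if "e \<in> {1..p - 1}" for e
    using that by force
  obtain w where w: "u = p ^ \<tau> * w" "\<not> p dvd w" by (rule u_decomp)
  have psiD: "psi_small k D" by (rule psi_small_level[OF k M D small_j])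
  define D' where "D' = D * real (p ^ k)"
  \<comment> \<open>Chains of level \<open>Suc k\<close> have no interior multiple of
    \<open>p ^ Suc k\<close>, so besides the start 0 only \<open>n\<close> prime to \<open>p\<close>
    carry weight.\<close>
  define b where "b n = (if n = 0 then 1 else if p dvd n then 0 else phi p a (Suc k) 0 (n * p ^ k))" for n
  define c where "c n = (if 1 \<le> n \<and> n < p then psi p a k 0 (n * p ^ k) else 0)" for n
  define B C where "B = Abs_fps b" and "C = Abs_fps c"
  define L where "L = fps_log_deriv B"
  define E where "E = fps_const (of_nat w) * L - C"
  define R where "R = fps_const (of_nat w) * (fps_X * fps_deriv B) - B * C"
  have B0: "fps_nth B 0 = 1" by (simp add: B_def b_def)
  have b_small: "small (b n) (D' * real n)" for n
  proof -
    have "small (phi p a (Suc k) 0 (n * p ^ k)) (D * (real (n * p ^ k) - real 0))" if "\<not> p dvd n"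
      using that p_gt_0 val_level_times by (intro phi_Suc_small psiD) (auto intro!: gr0I)
    then show ?thesis by (auto simp: b_def small_0 D'_def mult_ac small_absv_1 absv_1)
  qed
  have chi_sum: "chi k 0 (n * p ^ k) = (\<Sum>i<n. b i * psi p a k (i * p ^ k) (n * p ^ k))" if "n \<ge> 1" for n
  proof -
    have "(\<Sum>i\<in>{i\<in>{0<..<n}. \<not> p dvd i}. phi p a (Suc k) 0 (i * p ^ k) * psi p a k (i * p ^ k) (n * p ^ k))
        = (\<Sum>i\<in>{0<..<n}. b i * psi p a k (i * p ^ k) (n * p ^ k))"
      by (rule sum.mono_neutral_cong_left) (auto simp: b_def)
    moreover have "{..<n} = insert 0 {0<..<n}" using that by auto
    ultimately show ?thesis by (simp add: chi_0_eq_sum b_def)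
  qed
  have R_nth: "fps_nth R n = of_nat (w * n) * b n - (\<Sum>i<n. b i * c (n - i))" for n
  proof -
    have "fps_nth (B * C) n = (\<Sum>i=0..n. b i * c (n - i))"
      by (simp add: B_def C_def fps_mult_nth)
    also have "\<dots> = (\<Sum>i<n. b i * c (n - i))"
      by (simp add: atLeast0AtMost lessThan_Suc_atMost[symmetric] c_def)
    finally show ?thesis
      unfolding R_def fps_sub_nth fps_mult_left_const_nth fps_X_times_deriv_nth by (simp add: B_def)
  qed
  \<comment> \<open>Replacing each \<open>psi\<close> by its leading term \<open>c\<close> costs
    only terms whose valuation is higher by 1.\<close>
  have diff_small: "small (chi k 0 (n * p ^ k) - (\<Sum>i<n. b i * c (n - i))) (D' * real n + 1)"
    if n: "n \<ge> 1" for n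
  proof -
    have "small (b i * (psi p a k (i * p ^ k) (n * p ^ k) - c (n - i))) (D' * real n + 1)"
      if i: "i < n" for i
    proof -
      have eq: "i * p ^ k + (n - i) * p ^ k = n * p ^ k"
        using i by (simp flip: distrib_right)
      have "small (psi p a k (i * p ^ k) (n * p ^ k) - c (n - i)) (D * real ((n - i) * p ^ k) + 1)"
        using psi_near_initial[OF k M D, of "i * p ^ k" "n - i"] i
        unfolding eq by (simp add: c_def Suc_le_eq)
      then show ?thesis
        by (rule small_mult[OF b_small]) (use i in \<open>simp add: D'_def of_nat_diff algebra_simps\<close>)
    qed
    then show ?thesis
      by (auto simp: chi_sum[OF n] right_diff_distrib simp flip: sum_subtractf intro!: small_sum)
  qed
  have R_less: "absv (fps_nth R n) < q powr (D' * real n)" if n: "1 \<le> n" "n \<le> p * d" for n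
  proof (cases "p dvd n")
    case False
    then have "b n = kap k (n * p ^ k) * chi k 0 (n * p ^ k)"
      using n p_gt_0 by (simp add: b_def phi_Suc_eq_chi)
    then have "fps_nth R n = (of_nat (w * n) * kap k (n * p ^ k) - 1) * chi k 0 (n * p ^ k) +
        (chi k 0 (n * p ^ k) - (\<Sum>i<n. b i * c (n - i)))"
      unfolding R_nth by (simp add: algebra_simps)
    moreover have "small (chi k 0 (n * p ^ k)) (D * (real (n * p ^ k) - real 0))"
      using n p_gt_0 by (intro chi_small psiD) auto
    then have "small ((of_nat (w * n) * kap k (n * p ^ k) - 1) * chi k 0 (n * p ^ k)) (D' * real n + 1)"
      by (rule small_mult[OF kap_near[OF w False]]) (simp add: D'_def)
    ultimately have "small (fps_nth R n) (D' * real n + 1)"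
      using diff_small[OF n(1)] by (simp add: small_add)
    then show ?thesis
      using q_powr_less_iff[of "D' * real n + 1" "D' * real n"] by (simp add: small_def)
  next
    case True
    then obtain e where e: "n = e * p" by (metis dvd_div_mult_self)
    \<comment> \<open>From \<open>n \<le> p * d\<close> follows \<open>e \<le> d < p\<close>, so the
      contrary assumption applies to \<open>e\<close>.\<close>
    have e1: "e \<in> {1..p - 1}"
      using n d(1) p_gt_0 by (auto simp: e Suc_le_eq mult.commute intro!: gr0I)
    have "b n = 0" using n True by (simp add: b_def)
    then have "fps_nth R n = (chi k 0 (n * p ^ k) - (\<Sum>i<n. b i * c (n - i))) - chi k 0 (n * p ^ k)"
      by (simp add: R_nth)
    moreover have "absv (chi k 0 (n * p ^ k) - (\<Sum>i<n. b i * c (n - i))) < q powr (D' * real n)"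
      using diff_small[OF n(1)] q_powr_less_iff[of "D' * real n + 1" "D' * real n"] by (simp add: small_def)
    moreover have "absv (chi k 0 (n * p ^ k)) < q powr (D' * real n)"
    proof -
      have nk: "n * p ^ k = e * p ^ Suc k" by (simp add: e)
      have "absv (psi p a (Suc k) 0 (n * p ^ k)) = absv (chi k 0 (n * p ^ k)) * q powr pw k / q powr pw (Suc k)"
        using n p_gt_0 by (subst psi_Suc_eq_chi) (simp_all only: absv_divide absv_mult absv_one_minus_lam_pw, auto)
      then have "absv (chi k 0 (n * p ^ k)) =
          absv (psi p a (Suc k) 0 (n * p ^ k)) * q powr (pw (Suc k) - pw k)"
        using q_pos by (simp add: powr_diff)
      also have "\<dots> < q powr ((D - ep) * real (e * p ^ Suc k)) * q powr (pw (Suc k) - pw k)"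
        unfolding nk using psi_less[OF e1] q_pos by (intro mult_strict_right_mono) auto
      also have "\<dots> = q powr ((D - ep) * real (e * p ^ Suc k) + (pw (Suc k) - pw k))"
        by (simp only: powr_add)
      also have "\<dots> \<le> q powr (D' * real n)"
      proof -
        \<comment> \<open>The gap amounts to \<open>e * pw k\<close>, at most the
          \<open>(p - 1) * pw k\<close> by which the divisors of levels \<open>k\<close> and
          \<open>Suc k\<close> differ in valuation.\<close>
        have "real e * (ep * real (p ^ Suc k)) \<le> (real p - 1) * pw k"
          unfolding ep_mult using e1 pw_pos[of k] p_gt_0
          by (intro mult_right_mono) (auto simp: of_nat_diff)
        then have "D' * real n \<le> (D - ep) * real (e * p ^ Suc k) + (pw (Suc k) - pw k)"
          by (simp add: D'_def e pw_Suc algebra_simps)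
        then show ?thesis by (simp only: q_powr_le_iff)
      qed
      finally show ?thesis .
    qed
    ultimately show ?thesis
      using absv_diff_le_max[of "chi k 0 (n * p ^ k) - (\<Sum>i<n. b i * c (n - i))" "chi k 0 (n * p ^ k)"]
      by simp
  qed
  have "B * L = fps_X * fps_deriv B"
    unfolding L_def by (rule fps_log_deriv_mult_eq) (simp add: B0)
  then have BE: "B * E = R"
    by (simp add: E_def R_def algebra_simps)
  have E0: "fps_nth E 0 = 0"
    using arg_cong[OF BE, of "\<lambda>F. fps_nth F 0"] B0 by (simp add: R_nth)
  \<comment> \<open>\<open>B * E = R\<close> is solved for \<open>E\<close> degree by degree; as
    \<open>b i\<close> obeys the bound of slope \<open>D'\<close>, the strict bound passes from
    \<open>R\<close> to \<open>E\<close>.\<close>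
  have E_less: "absv (fps_nth E n) < q powr (D' * real n)" if "1 \<le> n" "n \<le> p * d" for n
    using that
  proof (induction n rule: less_induct)
    case (less n)
    have "fps_nth R n = (\<Sum>i=0..n. b i * fps_nth E (n - i))"
      by (simp add: B_def fps_mult_nth flip: BE)
    also have "\<dots> = fps_nth E n + (\<Sum>i=1..n. b i * fps_nth E (n - i))"
      by (simp add: sum.atLeast_Suc_atMost b_def)
    finally have "fps_nth E n = fps_nth R n - (\<Sum>i=1..n. b i * fps_nth E (n - i))"
      by simp
    moreover have "absv (\<Sum>i=1..n. b i * fps_nth E (n - i)) < q powr (D' * real n)"
    proof (rule absv_sum_less)
      fix i assume i: "i \<in> {1..n}"
      show "absv (b i * fps_nth E (n - i)) < q powr (D' * real n)"
      proof (cases "i = n")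
        case True
        then show ?thesis using E0 q_pos by simp
      next
        case False
        have "absv (b i * fps_nth E (n - i)) \<le> q powr (D' * real i) * absv (fps_nth E (n - i))"
          using b_small[of i] absv_nonneg by (auto simp: small_def absv_mult intro!: mult_right_mono)
        also have "\<dots> < q powr (D' * real i) * q powr (D' * real (n - i))"
          by (intro mult_strict_left_mono less.IH) (use less.prems False i q_pos in auto)
        also have "\<dots> = q powr (D' * real n)"
          using i by (simp add: of_nat_diff algebra_simps flip: powr_add)
        finally show ?thesis .
      qed
    qed (use q_pos in simp)
    ultimately show ?case
      using R_less[OF less.prems] absv_diff_le_max[of "fps_nth R n" "\<Sum>i=1..n. b i * fps_nth E (n - i)"]
      by simp
  qed
  have wL: "of_nat w * fps_nth L n = c n + fps_nth E n" for n
    by (simp add: E_def C_def)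
  have absL: "absv (of_nat w * fps_nth L n) = absv (fps_nth L n)" for n
    using absv_of_nat[OF w(2)] by (simp add: absv_mult)
  \<comment> \<open>In degree \<open>d\<close> the series \<open>w L\<close> is dominated by
    \<open>c d\<close>. In degree \<open>p * d\<close> only the smaller \<open>E\<close> is left,
    although Frobenius makes this coefficient of \<open>L\<close> the \<open>p\<close>-th power of
    the one at \<open>d\<close>.\<close>
  have cd: "absv (c d) = q powr (D' * real d)"
    using d p_gt_0 by (simp add: c_def D'_def mult_ac) linarith
  have "d \<le> p * d" using p_gt_0 by simp
  then have "absv (c d + fps_nth E d - c d) < absv (c d)"
    using E_less[of d] d cd by simp
  then have "absv (c d + fps_nth E d) = absv (c d)"
    by (rule absv_eq_of_diff_less)
  then have Ld: "absv (fps_nth L d) = q powr (D' * real d)"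
    using absL[of d] cd unfolding wL by simp
  have "c (p * d) = 0" using d by (auto simp: c_def)
  then have "absv (fps_nth L (p * d)) < q powr (D' * real (p * d))"
    using E_less[of "p * d"] absL[of "p * d"] wL[of "p * d"] d p_gt_0 by (simp add: Suc_le_eq)
  moreover have "fps_nth L (p * d) = fps_nth L d ^ p"
    unfolding L_def using fps_log_deriv_Frobenius[OF prime_p CHAR_p B0] d by simp
  then have "absv (fps_nth L (p * d)) = q powr (D' * real (p * d))"
    using Ld q_pos by (simp add: absv_power powr_power mult_ac)
  ultimately show False by simp
qed

text \<open>\<open>D\<close> lies below \<open>M\<close>, hence bounds the slopes of the lower
  levels as well as those of level \<open>k\<close>, and can take the place of \<open>M\<close> at
  level \<open>Suc k\<close>.\<close>

lemma dominant_step: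
  assumes k: "k \<ge> 1" and dom: "dominant_at k M"
  obtains D d where "D \<le> M - ep" "psi_small k D" "d \<in> {1..p - 1}"
    "absv (psi p a k 0 (d * p ^ k)) = q powr (D * real (d * p ^ k))" "dominant_at (Suc k) D"
proof -
  obtain D d where D: "D \<le> M - ep" and d: "d \<in> {1..p - 1}"
      "absv (psi p a k 0 (d * p ^ k)) = q powr (D * real (d * p ^ k))"
    and small_j: "\<And>j. j \<in> {1..p - 1} \<Longrightarrow> small (psi p a k 0 (j * p ^ k)) (D * real (j * p ^ k))"
    using ex_minimal_slope[OF assms] by blast
  have M: "\<And>l. l < k \<Longrightarrow> psi_small l M" using dom by (simp add: dominant_at_def)
  have psiD: "psi_small k D" by (rule psi_small_level[OF k M D small_j])
  have "psi_small l D" if "l < Suc k" for l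
    using that psiD psi_small_mono[OF M] D ep_pos by (cases "l = k") auto
  then have "dominant_at (Suc k) D"
    using dominant_step_aux[OF k M D d small_j] by (simp add: dominant_at_def)
  then show ?thesis using that D psiD d by blast
qed

lemma dominant_iterate:
  assumes "k \<ge> 1" "dominant_at k M"
  shows "\<exists>D. D \<le> M - real j * ep \<and> dominant_at (k + j) D"
proof (induction j)
  case 0
  then show ?case using assms by auto
next
  case (Suc j)
  then obtain D where D: "D \<le> M - real j * ep" "dominant_at (k + j) D" by blast
  then obtain D' where "D' \<le> D - ep" "dominant_at (Suc (k + j)) D'"
    using assms(1) dominant_step[of "k + j" D] by (metis trans_le_add1)
  then show ?case using D(1) by (intro exI[of _ D']) (auto simp: algebra_simps)
qed

end


section \<open>Divergence of the linearization\<close>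

lemma (in nonarch_field) locally_analytic_bound:
  assumes "locally_analytic absv h"
  obtains c n\<^sub>0 where "c \<ge> 1" "\<And>n. n \<ge> n\<^sub>0 \<Longrightarrow> absv (fps_nth h n) \<le> c ^ n"
proof -
  define L where "L = limsup (\<lambda>n. ereal (root n (absv (fps_nth h n))))"
  have "L \<noteq> \<infinity>"
    using assms by (auto simp: locally_analytic_def nonarch_conv_radius_def L_def[symmetric])
  then obtain m :: nat where "L < ereal (real m)"
    using less_PInf_Ex_of_nat[of L] by auto
  then have "eventually (\<lambda>n. ereal (root n (absv (fps_nth h n))) < ereal (real m)) sequentially"
    unfolding L_def by (rule Limsup_lessD)
  then obtain n\<^sub>0 where n0: "root n (absv (fps_nth h n)) < real m" if "n \<ge> n\<^sub>0" for n
    by (auto simp: eventually_sequentially)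
  have "absv (fps_nth h n) \<le> max 1 (real m) ^ n" if "n \<ge> Suc n\<^sub>0" for n
  proof -
    have "absv (fps_nth h n) = root n (absv (fps_nth h n)) ^ n"
      using that absv_nonneg by simp
    also have "\<dots> \<le> max 1 (real m) ^ n"
      using n0[of n] that absv_nonneg by (intro power_mono) auto
    finally show ?thesis .
  qed
  then show ?thesis by (intro that[of "max 1 (real m)" "Suc n\<^sub>0"]) auto
qed

text \<open>Composing with \<open>h\<close> on the right removes \<open>fps_inv h\<close>; the
  resulting equation is linear in the coefficients of \<open>b\<close>.\<close>

lemma linearizable_conjugacy:
  fixes f :: "'a::field fps"
  assumes "linearizable absv c f"
  obtains b where "fps_nth b 0 \<noteq> 0" "locally_analytic absv (fps_X * b)"
    "(fps_X * b) oo f = fps_const c * (fps_X * b)"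
proof -
  from assms obtain b h where h: "h = fps_X * b" "fps_nth b 0 \<noteq> 0" "locally_analytic absv h"
    and eq: "h oo f oo fps_inv h = fps_const c * fps_X"
    by (auto simp: linearizable_def)
  have h0: "fps_nth h 0 = 0" "fps_nth h 1 \<noteq> 0" using h by simp_all
  have i0: "fps_nth (fps_inv h) 0 = 0" by (simp add: fps_inv_def)
  have "h oo f = (h oo f) oo (fps_inv h oo h)"
    by (simp add: fps_inv[OF h0])
  also have "\<dots> = (fps_const c * fps_X) oo h"
    by (simp add: fps_compose_assoc[OF h0(1) i0] eq)
  also have "\<dots> = fps_const c * h"
    by (simp add: h0 flip: fps_const_mult_apply_left)
  finally show ?thesis using that h by blast
qed

lemma Phi_eq_0:
  assumes "\<not> exp_gcd a dvd s - r"
  shows "Phi a r s = 0"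
proof -
  have "multi_indices (exp_gcd a) r s = {}"
  proof (rule ccontr)
    assume "multi_indices (exp_gcd a) r s \<noteq> {}"
    then obtain \<alpha> where \<alpha>: "\<alpha> \<in> multi_indices (exp_gcd a) r s" by blast
    then have "exp_gcd a dvd i * \<alpha> i" for i
      by (cases "exp_gcd a dvd i") (auto simp: multi_indices_def)
    then have "exp_gcd a dvd (\<Sum>i=1..s - r. i * \<alpha> i)" by (intro dvd_sum)
    then show False using \<alpha> assms by (simp add: multi_indices_def)
  qed
  then show ?thesis by (simp add: Phi_def)
qed

section \<open>Coefficients of the linearization\<close>

context near_identity
begin

text \<open>Coefficients are compared at \<open>Suc s\<close>: the term \<open>r = s\<close> is
  \<open>lam ^ Suc s\<close> times \<open>fps_nth b s\<close>, and moved to the other side it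
  produces the divisor \<open>lam * (1 - lam ^ s)\<close> of \<open>Phi\<close>.\<close>

lemma conjugacy_coeff:
  assumes eq: "(fps_X * b) oo (fps_X * Abs_fps a) = fps_const lam * (fps_X * b)" and s: "s \<ge> 1"
  shows "fps_nth b s = (\<Sum>r<s. fps_nth b r * Phi a r s)"
proof -
  have "lam * fps_nth b s = fps_nth ((fps_X * b) oo (fps_X * Abs_fps a)) (Suc s)"
    unfolding eq by simp
  also have "\<dots> = (\<Sum>i=0..Suc s. fps_nth (fps_X * b) i * fps_nth ((fps_X * Abs_fps a) ^ i) (Suc s))"
    by (rule fps_compose_nth)
  also have "\<dots> = (\<Sum>r=0..s. fps_nth b r * fps_nth (Abs_fps a ^ Suc r) (s - r))"
    unfolding power_mult_distrib
    by (subst sum.atLeast0_atMost_Suc_shift)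
      (auto simp: fps_X_power_mult_nth simp del: power_Suc intro!: sum.cong)
  also have "\<dots> = (\<Sum>r<s. fps_nth b r * fps_nth (Abs_fps a ^ Suc r) (s - r)) + fps_nth b s * lam ^ Suc s"
    by (simp add: atLeast0AtMost lessThan_Suc_atMost[symmetric] fps_power_zeroth del: power_Suc)
  also have "(\<Sum>r<s. fps_nth b r * fps_nth (Abs_fps a ^ Suc r) (s - r))
      = (\<Sum>r<s. fps_nth b r * Phi a r s) * (lam * (1 - lam ^ s))"
  proof -
    have "lam * (1 - lam ^ s) \<noteq> 0" using lam_nonzero not_root_of_unity[OF s] by simp
    then show ?thesis
      unfolding sum_distrib_right
      by (intro sum.cong) (simp_all add: Phi_eq_fps_power_nth less_imp_le del: power_Suc)
  qed
  finally have "(lam * (1 - lam ^ s)) * fps_nth b s =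
      (lam * (1 - lam ^ s)) * (\<Sum>r<s. fps_nth b r * Phi a r s)"
    by (simp add: algebra_simps)
  moreover have "lam * (1 - lam ^ s) \<noteq> 0" using lam_nonzero not_root_of_unity[OF s] by simp
  ultimately show ?thesis using mult_left_cancel by blast
qed

lemma conjugacy_renewal:
  assumes rec: "\<And>s. s \<ge> 1 \<Longrightarrow> x s = (\<Sum>r<s. x r * Phi a r s)" and s: "s \<ge> 1"
  shows "x (u * s) = (\<Sum>t<s. x (u * t) * Phi a (u * t) (u * s))"
proof -
  \<comment> \<open>Starting from \<open>x 0\<close>, nonzero weights lead only to multiples of
    \<open>u\<close>.\<close>
  have supp: "x n = 0" if "\<not> u dvd n" for n
    using that
  proof (induction n rule: less_induct)
    case (less n)
    have "x r * Phi a r n = 0" if "r < n" for r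
    proof (cases "u dvd r")
      case True
      then have "\<not> u dvd n - r"
        using less.prems that by (metis dvd_diffD less_imp_le)
      then show ?thesis by (simp add: Phi_eq_0)
    qed (use less that in simp)
    then have "(\<Sum>r<n. x r * Phi a r n) = 0" by (intro sum.neutral) simp
    then show ?case using less.prems rec[of n] by (cases "n = 0") auto
  qed
  have "x (u * s) = (\<Sum>r<u * s. x r * Phi a r (u * s))"
    using rec[of "u * s"] s u_pos by (simp add: Suc_le_eq)
  also have "\<dots> = (\<Sum>r\<in>(*) u ` {..<s}. x r * Phi a r (u * s))"
  proof (rule sum.mono_neutral_right)
    show "\<forall>i\<in>{..<u * s} - (*) u ` {..<s}. x i * Phi a i (u * s) = 0"
    proof
      fix i assume i: "i \<in> {..<u * s} - (*) u ` {..<s}"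
      then have "\<not> u dvd i" using u_pos by (auto elim!: dvdE)
      then show "x i * Phi a i (u * s) = 0" using supp by simp
    qed
  qed (use u_pos in auto)
  also have "\<dots> = (\<Sum>t<s. x (u * t) * Phi a (u * t) (u * s))"
    using u_pos by (simp add: sum.reindex inj_on_def)
  finally show ?thesis .
qed

text \<open>Local analyticity bounds \<open>x\<close> geometrically, at some rate \<open>T\<close>.
  At a level \<open>K\<close> whose slope \<open>D\<close> is below \<open>- T\<close>, cutting at
  multiples of \<open>p ^ K\<close> expresses \<open>phi p a K 0 s\<close> by terms too small for
  the size that \<open>D\<close> prescribes.\<close>

lemma not_linearizable_if_dominant_at:
  assumes k: "k \<ge> 1" and dom: "dominant_at k M"
  shows "\<not> linearizable absv lam (fps_X * Abs_fps a)"
proof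
  assume "linearizable absv lam (fps_X * Abs_fps a)"
  then obtain b where b0: "fps_nth b 0 \<noteq> 0" and an: "locally_analytic absv (fps_X * b)"
    and eq: "(fps_X * b) oo (fps_X * Abs_fps a) = fps_const lam * (fps_X * b)"
    by (rule linearizable_conjugacy)
  obtain c n\<^sub>0 where c: "c \<ge> 1" "\<And>n. n \<ge> n\<^sub>0 \<Longrightarrow> absv (fps_nth (fps_X * b) n) \<le> c ^ n"
    using locally_analytic_bound[OF an] by blast
  define x where "x s = fps_nth b (u * s) / fps_nth b 0" for s
  have x_rec: "x s = Phi a (u * 0) (u * s) + (\<Sum>t\<in>{0<..<s} \<inter> UNIV. x t * Phi a (u * t) (u * s))"
    if s: "0 < s" for s
  proof -
    have "fps_nth b (u * s) = (\<Sum>t<s. fps_nth b (u * t) * Phi a (u * t) (u * s))"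
      by (rule conjugacy_renewal[OF conjugacy_coeff[OF eq]]) (use s in auto)
    then have "x s = (\<Sum>t<s. x t * Phi a (u * t) (u * s))"
      by (simp add: x_def sum_divide_distrib)
    moreover have "{..<s} = insert 0 {0<..<s}" using s by auto
    ultimately show ?thesis using b0 by (simp add: x_def)
  qed
  \<comment> \<open>\<open>\<beta>\<close> absorbs the division by \<open>fps_nth b 0\<close>; the
    exponent \<open>2 * u\<close> makes room for the shift by one in \<open>fps_X * b\<close>, as
    \<open>Suc (u * s) \<le> 2 * u * s\<close>.\<close>
  define \<beta> where "\<beta> = max 1 (1 / absv (fps_nth b 0))"
  define T where "T = - log q (c ^ (2 * u) * \<beta>)"
  have qT: "q powr (- T) = c ^ (2 * u) * \<beta>"
    using q_pos q_less_1 c(1) by (simp add: T_def \<beta>_def)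
  have x_le: "absv (x s) \<le> q powr (- T * real s)" if s: "s \<ge> 1" "s \<ge> n\<^sub>0" for s
  proof -
    have us: "u * s \<ge> n\<^sub>0" "u * s \<ge> 1" using s u_pos by (auto intro: order_trans simp: Suc_le_eq)
    have "absv (fps_nth b (u * s)) \<le> c ^ Suc (u * s)"
      using c(2)[of "Suc (u * s)"] us by simp
    also have "\<dots> \<le> c ^ (2 * u * s)"
      using c(1) us by (intro power_increasing) auto
    finally have "absv (x s) \<le> c ^ (2 * u * s) * \<beta>"
      unfolding x_def divide_inverse absv_mult absv_inverse
      using absv_nonneg c(1) by (intro mult_mono) (auto simp: \<beta>_def divide_inverse)
    also have "\<dots> \<le> c ^ (2 * u * s) * \<beta> ^ s"
      using c(1) s power_increasing[of 1 s \<beta>] by (intro mult_left_mono) (auto simp: \<beta>_def)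
    also have "\<dots> = (q powr (- T)) ^ s"
      by (simp add: qT power_mult power_mult_distrib)
    also have "\<dots> = q powr (- T * real s)"
      using q_pos by (simp add: powr_power mult.commute)
    finally show ?thesis .
  qed
  obtain j where j: "M - real j * ep < - T" "j \<ge> n\<^sub>0"
  proof -
    obtain j :: nat where "real j > (M + T) / ep" using reals_Archimedean2 by blast
    then have "M + T < real j * ep" using ep_pos by (simp add: divide_less_eq)
    also have "\<dots> \<le> real (max j n\<^sub>0) * ep" using ep_pos by (intro mult_right_mono) auto
    finally show ?thesis using that[of "max j n\<^sub>0"] by simp
  qed
  define K where "K = k + j"
  have K: "K \<ge> 1" using k by (simp add: K_def)
  obtain M' where M': "M' \<le> M - real j * ep" "dominant_at K M'"
    using dominant_iterate[OF k dom, of j] by (auto simp: K_def)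
  obtain D d where D: "D \<le> M' - ep" "psi_small K D" and d: "d \<in> {1..p - 1}"
    and psi_d: "absv (psi p a K 0 (d * p ^ K)) = q powr (D * real (d * p ^ K))"
    using dominant_step[OF K M'(2)] by metis
  have DT: "D < - T" using D(1) M'(1) j(1) ep_pos by simp
  have "n\<^sub>0 \<le> p ^ K"
  proof -
    have "n\<^sub>0 \<le> K" using j(2) by (simp add: K_def)
    also have "K \<le> p ^ K" using power_gt_expt[of p K] p_gt_1 by simp
    finally show ?thesis .
  qed
  have x_less: "absv (x t) < q powr (D * real t)" if t: "p ^ K dvd t" "t > 0" for t
  proof -
    have "t \<ge> n\<^sub>0" using \<open>n\<^sub>0 \<le> p ^ K\<close> dvd_imp_le[OF t] by (rule order_trans)
    then have "absv (x t) \<le> q powr (- T * real t)" using t by (intro x_le) auto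
    also have "\<dots> < q powr (D * real t)"
      unfolding q_powr_less_iff using DT t by (intro mult_strict_right_mono) simp_all
    finally show ?thesis .
  qed
  define s where "s = d * p ^ K"
  have s: "s > 0" "p ^ K dvd s" using d p_gt_0 by (auto simp: s_def)
  have "\<not> p dvd d" using d by (auto dest: dvd_imp_le)
  then have "s \<in> val_level K" using val_level_times by (simp add: s_def)
  then have kap_s: "absv (kap K s) = 1" by (rule absv_kap)
  have "{t. \<not> p ^ K dvd t} \<subseteq> UNIV" "UNIV - {t. \<not> p ^ K dvd t} = {t. p ^ K dvd t}" by auto
  \<comment> \<open>\<open>x\<close> satisfies the recursion for chains with arbitrary interior
    points, the case \<open>B = UNIV\<close> of \<open>renewal_refine\<close>.\<close>
  then have "x s = phi p a K 0 s + (\<Sum>t\<in>{0<..<s} \<inter> {t. p ^ K dvd t}. x t * phi p a K t s)"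
    using renewal_refine[of 0 x "\<lambda>r s. Phi a (u * r) (u * s)" UNIV "phi p a K"
        "{t. \<not> p ^ K dvd t}" s, OF x_rec phi_rec] s by simp
  then have "phi p a K 0 s = x s - (\<Sum>t\<in>{0<..<s} \<inter> {t. p ^ K dvd t}. x t * phi p a K t s)"
    by simp
  moreover have "absv (x s) < q powr (D * real s)" using x_less s by simp
  moreover have "absv (\<Sum>t\<in>{0<..<s} \<inter> {t. p ^ K dvd t}. x t * phi p a K t s) < q powr (D * real s)"
  proof (rule absv_sum_less)
    fix t assume t: "t \<in> {0<..<s} \<inter> {t. p ^ K dvd t}"
    have "small (psi p a K t s) (D * (real s - real t))"
      using D(2) t s by (auto simp: psi_small_def)
    then have "absv (phi p a K t s) \<le> q powr (D * (real s - real t))"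
      using s kap_s by (simp add: phi_eq_psi absv_mult small_def)
    then have "absv (x t * phi p a K t s) \<le> absv (x t) * q powr (D * (real s - real t))"
      using absv_nonneg by (simp add: absv_mult mult_left_mono)
    also have "\<dots> < q powr (D * real t) * q powr (D * (real s - real t))"
      using x_less t q_pos by (intro mult_strict_right_mono) auto
    also have "\<dots> = q powr (D * real s)"
      by (simp add: algebra_simps flip: powr_add)
    finally show "absv (x t * phi p a K t s) < q powr (D * real s)" .
  qed (use q_pos in simp)
  ultimately have "absv (phi p a K 0 s) < q powr (D * real s)"
    using absv_diff_le_max[of "x s" "\<Sum>t\<in>{0<..<s} \<inter> {t. p ^ K dvd t}. x t * phi p a K t s"]
    by simp
  then show False
    using s kap_s psi_d by (simp add: phi_eq_psi absv_mult s_def)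
qed

section \<open>From extended-real slopes to real bounds\<close>

lemma val_base_le_iff:
  assumes "n > 0"
  shows "val_base absv (lam - 1) x / ereal (real n) \<le> ereal t \<longleftrightarrow> q powr (t * real n) \<le> absv x"
    and "ereal t \<le> val_base absv (lam - 1) x / ereal (real n) \<longleftrightarrow> small x (t * real n)"
proof -
  have lnq: "ln q < 0" using q_pos q_less_1 by simp
  have 1: "absv x > 0" if "x \<noteq> 0" using that absv_nonneg[of x] by (auto simp: absv_eq_0_iff less_le)
  have pow: "q powr (ln (absv x) / ln q) = absv x" if "x \<noteq> 0"
    using 1[OF that] lnq q_pos by (simp add: powr_def)
  have "ln (absv x) / ln q / real n \<le> t \<longleftrightarrow> q powr (t * real n) \<le> absv x" if "x \<noteq> 0"
  proof -
    have "ln (absv x) / ln q / real n \<le> t \<longleftrightarrow> ln (absv x) / ln q \<le> t * real n"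
      using assms by (intro pos_divide_le_eq) simp
    then show ?thesis
      using q_powr_le_iff[of "t * real n" "ln (absv x) / ln q"] pow[OF that] by simp
  qed
  then show "val_base absv (lam - 1) x / ereal (real n) \<le> ereal t \<longleftrightarrow> q powr (t * real n) \<le> absv x"
    using assms q_pos by (cases "x = 0") (simp_all add: val_base_def not_le flip: q_def)
  have "t \<le> ln (absv x) / ln q / real n \<longleftrightarrow> small x (t * real n)" if "x \<noteq> 0"
  proof -
    have "t \<le> ln (absv x) / ln q / real n \<longleftrightarrow> t * real n \<le> ln (absv x) / ln q"
      using assms by (intro pos_le_divide_eq) simp
    then show ?thesis
      using q_powr_le_iff[of "ln (absv x) / ln q" "t * real n"] pow[OF that]
      by (simp add: small_def)
  qed
  then show "ereal t \<le> val_base absv (lam - 1) x / ereal (real n) \<longleftrightarrow> small x (t * real n)"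
    using assms q_pos by (cases "x = 0") (simp_all add: val_base_def small_0 flip: q_def)
qed

text \<open>For some \<open>a n \<noteq> 0\<close> with \<open>n = u * s\<close>,
  \<open>psi p a 0 0 s\<close> is a nonzero multiple of \<open>a n\<close>, so its slope is
  finite.\<close>

lemma M_inf_0_finite: "M_inf absv p a 0 \<noteq> \<infinity>"
proof -
  obtain n where n: "n \<ge> 1" "a n \<noteq> 0" using nonlinear by blast
  then obtain s where s: "n = u * s" using exp_gcd_dvd by blast
  then have "s > 0" using n by (auto intro: gr0I)
  have "psi p a 0 0 s \<noteq> 0"
    using n s \<open>s > 0\<close> lam_nonzero one_minus_lam_pw_nonzero[of 0] by (simp add: psi_0 pow_coeff_def)
  then have "M_val absv p a 0 0 s \<noteq> \<infinity>"
    using \<open>s > 0\<close> by (simp add: M_val_def val_base_def)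
  moreover have "M_inf absv p a 0 \<le> M_val absv p a 0 0 s"
    unfolding M_inf_def using \<open>s > 0\<close> by (intro Inf_lower) auto
  ultimately show ?thesis by auto
qed

lemma dominant_at_if_k_dominant:
  assumes k: "k \<ge> 1" and dom: "k_dominant absv p a k"
  obtains M where "dominant_at k M"
proof -
  define m where "m = Min (M_inf absv p a ` {0..k - 1})"
  have le: "Min ((\<lambda>d. M_val absv p a k 0 (d * p ^ k)) ` {1..p - 1}) \<le> m - ereal ep"
    using dom by (simp add: k_dominant_def m_def ep_def)
  have "Min ((\<lambda>d. M_val absv p a k 0 (d * p ^ k)) ` {1..p - 1})
      \<in> (\<lambda>d. M_val absv p a k 0 (d * p ^ k)) ` {1..p - 1}"
    using p_gt_1 by (intro Min_in) auto
  then obtain d where d: "d \<in> {1..p - 1}" "M_val absv p a k 0 (d * p ^ k) \<le> m - ereal ep"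
    using le by auto
  have dpos: "d * p ^ k > 0" using d(1) p_gt_0 by simp
  have "m \<noteq> \<infinity>"
  proof -
    have "m \<le> M_inf absv p a 0" unfolding m_def by (intro Min_le) auto
    then show ?thesis using M_inf_0_finite by auto
  qed
  \<comment> \<open>A single slope is never \<open>-\<infinity>\<close>, so the dominance inequality
    at the witness \<open>d\<close> excludes this value of \<open>m\<close>.\<close>
  moreover have "m \<noteq> -\<infinity>"
  proof
    assume "m = -\<infinity>"
    then have "M_val absv p a k 0 (d * p ^ k) = -\<infinity>" using d(2) by simp
    then show False using dpos by (auto simp: M_val_def val_base_def split: if_splits)
  qed
  ultimately obtain M where M: "m = ereal M" by (cases m) auto
  have "psi_small l M" if l: "l < k" for l
    unfolding psi_small_def
  proof (intro allI impI)
    fix r s assume rs: "r < s" "p ^ l dvd r" "p ^ l dvd s"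
    have "m \<le> M_inf absv p a l" unfolding m_def using l by (intro Min_le) auto
    also have "\<dots> \<le> M_val absv p a l r s"
      unfolding M_inf_def using rs by (intro Inf_lower) auto
    finally have "small (psi p a l r s) (M * real (s - r))"
      using rs val_base_le_iff(2)[of "s - r" M "psi p a l r s"] by (simp add: M M_val_def)
    then show "small (psi p a l r s) (M * (real s - real r))"
      using rs by (simp add: of_nat_diff)
  qed
  moreover have "q powr ((M - ep) * real (d * p ^ k)) \<le> absv (psi p a k 0 (d * p ^ k))"
    using d(2) val_base_le_iff(1)[OF dpos, of "psi p a k 0 (d * p ^ k)" "M - ep"]
    by (simp add: M M_val_def)
  ultimately have "dominant_at k M" using d(1) by (auto simp: dominant_at_def)
  then show ?thesis by (rule that)
qed

end

theorem mainTheorem1: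
  fixes absv :: "'a::field \<Rightarrow> real" and p :: nat and lam :: 'a
    and a :: "nat \<Rightarrow> 'a" and f :: "'a fps" and k :: nat
  assumes "prime p"
    and "complete_nonarch_field absv"
    and "CHAR('a) = p"
    and "\<forall>n\<ge>1. lam ^ n \<noteq> 1"
    and "absv (1 - lam) < 1"
    and "a 0 = lam"
    and "f = fps_X * Abs_fps a"
    and "locally_analytic absv f"
    and "\<exists>n\<ge>1. a n \<noteq> 0"
    and "k \<ge> 1"
    and "k_dominant absv p a k"
  shows "\<not> linearizable absv lam f"
proof -
  interpret complete_nonarch_field absv by (rule assms(2))
  interpret near_identity absv p a
    by unfold_locales (use assms in auto)
  obtain M where "dominant_at k M"
    using dominant_at_if_k_dominant assms by blast
  then show ?thesis
    using not_linearizable_if_dominant_at assms by blast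
qed

end
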